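(* Let $G$ be a non-planar ribbon graph. Then there exists a subdivision $G'$ of $G$ with at most two more vertices than $G$ such that some Bernardi bijection on $G'$ is not a cycle orientation map, and hence is not geometric.
   Context: Graphs are finite and connected, possibly with parallel edges but without loops; cycles are simple. A ribbon graph is a graph with a cyclic ordering of edges around each vertex; it is planar if the associated embedding into a closed orientable surface is into the sphere. A subdivision of a ribbon graph is obtained by inserting degree-2 vertices into edges, keeping the cyclic orders at original vertices. Bernardi bijection: fix a starting pair $(v,e)$ with $v$ an endpoint of edge $e$; for a spanning tree $T$, run the tour $(v_0,e_0)=(v,e)$; if $e_i\notin T$ then $v_{i+1}=v_i$ and $e_{i+1}$ is the edge after $e_i$ in the cyclic order at $v_i$; if $e_i\in T$ then $v_{i+1}$ is the other endpoint of $e_i$ and $e_{i+1}$ is the edge after $e_i$ in the cyclic order at $v_{i+1}$; stop when every edge has been traversed twice. For $f\notin T$, $\eta(f)$ is the vertex at the first occurrence of $f$, and $\beta_{(v,e)}(T)=\sum_{f\notin T}(\eta(f))$. A cycle orientation configuration assigns an orientation to every cycle; its cycle orientation map sends $T$ to the divisor obtained by orienting each $f\notin T$ as it is traversed by the oriented unique cycle in $T+f$ and placing a chip at the head of $f$. A map is a cycle orientation map if it equals the cycle orientation map of some configuration. A configuration (map) is geometric if, with edges given reference orientations and oriented cycles identified with signed edge sums in $C_1(G,\mathbb{R})$ (orthonormal basis $E$), there is $\mathbf{w}$ in the span of cycles with $\langle\mathbf{w},C\rangle>0$ for every configuration-oriented cycle $C$; geometric maps are in particular cycle orientation maps. *)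

theory Defs
  imports Complex_Main "HOL-Combinatorics.Orbits"
begin

text \<open>
  \<open>nxt G v e\<close> is the edge after \<open>e\<close> in the cyclic order at \<open>v\<close>; only its values on the edges
  incident to \<open>v\<close> matter.  Since there are no loops, each such edge occurs once in this order.
\<close>

record ('v, 'e) ribbon =
  verts :: "'v set"
  edges :: "'e set"
  ends :: "'e \<Rightarrow> 'v set"
  nxt :: "'v \<Rightarrow> 'e \<Rightarrow> 'e"

definition incident :: "('v, 'e) ribbon \<Rightarrow> 'v \<Rightarrow> 'e set" where
  "incident G v = {e \<in> edges G. v \<in> ends G e}"

definition other_end :: "('v, 'e) ribbon \<Rightarrow> 'e \<Rightarrow> 'v \<Rightarrow> 'v" where
  "other_end G e v = the_elem (ends G e - {v})"

definition connected_by :: "('v, 'e) ribbon \<Rightarrow> 'e set \<Rightarrow> bool" where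
  "connected_by G A \<longleftrightarrow>
    (\<forall>u\<in>verts G. \<forall>v\<in>verts G. (u, v) \<in> {(x, y). \<exists>e\<in>A. ends G e = {x, y}}\<^sup>*)"

locale ribbon_graph =
  fixes G :: "('v, 'e) ribbon"
  assumes finite_verts: "finite (verts G)"
    and verts_nonempty: "verts G \<noteq> {}"
    and finite_edges: "finite (edges G)"
    and ends_verts: "e \<in> edges G \<Longrightarrow> ends G e \<subseteq> verts G"
    and ends_card: "e \<in> edges G \<Longrightarrow> card (ends G e) = 2"
    and connected: "connected_by G (edges G)"
    and nxt_cyclic: "\<lbrakk>v \<in> verts G; incident G v \<noteq> {}\<rbrakk> \<Longrightarrow> cyclic_on (nxt G v) (incident G v)"


subsection \<open>Planarity\<close>

text \<open>
  A pair \<open>(v, e)\<close> with \<open>v\<close> an end of \<open>e\<close> is a half-edge.  The surface associated with a ribbon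
  graph is obtained by gluing one disk along every boundary walk of the ribbon surface, and these
  walks are the orbits of the face permutation below.  The result is a closed connected orientable
  surface of Euler characteristic \<open>|V| - |E| + |F|\<close>, hence the sphere iff this number is 2.
  The graph consisting of a single vertex has one face but no half-edge.
\<close>

definition half_edges :: "('v, 'e) ribbon \<Rightarrow> ('v \<times> 'e) set" where
  "half_edges G = {(v, e). e \<in> edges G \<and> v \<in> ends G e}"

definition face_perm :: "('v, 'e) ribbon \<Rightarrow> 'v \<times> 'e \<Rightarrow> 'v \<times> 'e" where
  "face_perm G = (\<lambda>(v, e). let u = other_end G e v in (u, nxt G u e))"

definition num_faces :: "('v, 'e) ribbon \<Rightarrow> nat" where
  "num_faces G = (if edges G = {} then 1 else card (orbit (face_perm G) ` half_edges G))"

definition euler_char :: "('v, 'e) ribbon \<Rightarrow> int" where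
  "euler_char G = int (card (verts G)) - int (card (edges G)) + int (num_faces G)"

definition planar :: "('v, 'e) ribbon \<Rightarrow> bool" where
  "planar G \<longleftrightarrow> euler_char G = 2"


subsection \<open>Subdivisions\<close>

text \<open>
  \<open>subdivide G d n\<close> inserts \<open>n e\<close> new vertices into each edge \<open>e\<close>.  The function \<open>d\<close> selects the end
  of \<open>e\<close> from which the new vertices \<open>Inr (e, 0), \<dots>, Inr (e, n e - 1)\<close> and the pieces
  \<open>(e, 0), \<dots>, (e, n e)\<close> of \<open>e\<close> are numbered.  Up to the naming of vertices and edges, every
  subdivision is of this form.
\<close>

definition sub_point ::
    "('v, 'e) ribbon \<Rightarrow> ('e \<Rightarrow> 'v) \<Rightarrow> ('e \<Rightarrow> nat) \<Rightarrow> 'e \<Rightarrow> nat \<Rightarrow> 'v + 'e \<times> nat" where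
  "sub_point G d n e i =
    (if i = 0 then Inl (d e)
     else if i = Suc (n e) then Inl (other_end G e (d e))
     else Inr (e, i - 1))"

fun sub_nxt ::
    "('v, 'e) ribbon \<Rightarrow> ('e \<Rightarrow> 'v) \<Rightarrow> ('e \<Rightarrow> nat) \<Rightarrow> 'v + 'e \<times> nat \<Rightarrow> 'e \<times> nat \<Rightarrow> 'e \<times> nat" where
  "sub_nxt G d n (Inl v) (e, i) = (let f = nxt G v e in (f, if d f = v then 0 else n f))"
| "sub_nxt G d n (Inr (e, j)) (f, i) = (if i = j then (e, Suc j) else (e, j))"

definition subdivide ::
    "('v, 'e) ribbon \<Rightarrow> ('e \<Rightarrow> 'v) \<Rightarrow> ('e \<Rightarrow> nat) \<Rightarrow> ('v + 'e \<times> nat, 'e \<times> nat) ribbon" where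
  "subdivide G d n =
    \<lparr>verts = Inl ` verts G \<union> {Inr (e, i) |e i. e \<in> edges G \<and> i < n e},
     edges = {(e, i). e \<in> edges G \<and> i \<le> n e},
     ends = (\<lambda>(e, i). {sub_point G d n e i, sub_point G d n e (Suc i)}),
     nxt = sub_nxt G d n\<rparr>"

definition subdivision ::
    "('v, 'e) ribbon \<Rightarrow> ('v + 'e \<times> nat, 'e \<times> nat) ribbon \<Rightarrow> bool" where
  "subdivision G G' \<longleftrightarrow> (\<exists>d n. (\<forall>e\<in>edges G. d e \<in> ends G e) \<and> G' = subdivide G d n)"


subsection \<open>Cycles and spanning trees\<close>

text \<open>
  An oriented simple cycle is encoded as the set of its edges, each paired with the vertex at
  which the oriented edge points; this set does not depend on where the cycle starts.  Two parallel
  edges form a cycle of length 2.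
\<close>

definition oriented_cycle :: "('v, 'e) ribbon \<Rightarrow> ('e \<times> 'v) set \<Rightarrow> bool" where
  "oriented_cycle G D \<longleftrightarrow>
    (\<exists>vs es. length vs = length es \<and> 2 \<le> length es \<and> distinct vs \<and> distinct es \<and>
       set es \<subseteq> edges G \<and>
       (\<forall>i<length es. ends G (es ! i) = {vs ! i, vs ! (Suc i mod length es)}) \<and>
       D = {(es ! i, vs ! (Suc i mod length es)) |i. i < length es})"

definition is_cycle :: "('v, 'e) ribbon \<Rightarrow> 'e set \<Rightarrow> bool" where
  "is_cycle G C \<longleftrightarrow> (\<exists>D. oriented_cycle G D \<and> C = fst ` D)"

definition spanning_tree :: "('v, 'e) ribbon \<Rightarrow> 'e set \<Rightarrow> bool" where
  "spanning_tree G T \<longleftrightarrow>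
    T \<subseteq> edges G \<and> connected_by G T \<and> (\<forall>C. is_cycle G C \<longrightarrow> \<not> C \<subseteq> T)"

definition fundamental_cycle :: "('v, 'e) ribbon \<Rightarrow> 'e set \<Rightarrow> 'e \<Rightarrow> 'e set" where
  "fundamental_cycle G T f = (THE C. is_cycle G C \<and> C \<subseteq> insert f T)"


subsection \<open>Divisors and cycle orientation maps\<close>

type_synonym 'v divisor = "'v \<Rightarrow> int"

definition chip :: "'v \<Rightarrow> 'v divisor" where
  "chip v = (\<lambda>u. of_bool (u = v))"

definition cycle_orientation_config :: "('v, 'e) ribbon \<Rightarrow> ('e set \<Rightarrow> ('e \<times> 'v) set) \<Rightarrow> bool" where
  "cycle_orientation_config G \<sigma> \<longleftrightarrow>
    (\<forall>C. is_cycle G C \<longrightarrow> oriented_cycle G (\<sigma> C) \<and> fst ` \<sigma> C = C)"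

definition head_in :: "('e \<times> 'v) set \<Rightarrow> 'e \<Rightarrow> 'v" where
  "head_in D f = (THE v. (f, v) \<in> D)"

definition cycle_orientation_map ::
    "('v, 'e) ribbon \<Rightarrow> ('e set \<Rightarrow> ('e \<times> 'v) set) \<Rightarrow> 'e set \<Rightarrow> 'v divisor" where
  "cycle_orientation_map G \<sigma> T =
    (\<lambda>u. \<Sum>f\<in>edges G - T. chip (head_in (\<sigma> (fundamental_cycle G T f)) f) u)"

definition is_cycle_orientation_map :: "('v, 'e) ribbon \<Rightarrow> ('e set \<Rightarrow> 'v divisor) \<Rightarrow> bool" where
  "is_cycle_orientation_map G F \<longleftrightarrow>
    (\<exists>\<sigma>. cycle_orientation_config G \<sigma> \<and>
      (\<forall>T. spanning_tree G T \<longrightarrow> F T = cycle_orientation_map G \<sigma> T))"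


subsection \<open>Geometric maps\<close>

text \<open>
  Elements of \<open>C\<^sub>1(G, \<real>)\<close> are coordinate functions on the edges.  A reference orientation \<open>r\<close> is given by
  the head of each edge; \<open>signed_sum r D\<close> is the signed edge sum of the oriented cycle \<open>D\<close>.
\<close>

definition reference_orientation :: "('v, 'e) ribbon \<Rightarrow> ('e \<Rightarrow> 'v) \<Rightarrow> bool" where
  "reference_orientation G r \<longleftrightarrow> (\<forall>e\<in>edges G. r e \<in> ends G e)"

definition signed_sum :: "('e \<Rightarrow> 'v) \<Rightarrow> ('e \<times> 'v) set \<Rightarrow> 'e \<Rightarrow> real" where
  "signed_sum r D e = (if (e, r e) \<in> D then 1 else if e \<in> fst ` D then -1 else 0)"

definition in_cycle_span :: "('v, 'e) ribbon \<Rightarrow> ('e \<Rightarrow> 'v) \<Rightarrow> ('e \<Rightarrow> real) \<Rightarrow> bool" where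
  "in_cycle_span G r w \<longleftrightarrow>
    (\<exists>c. \<forall>e\<in>edges G. w e = (\<Sum>D | oriented_cycle G D. c D * signed_sum r D e))"

definition geometric_config :: "('v, 'e) ribbon \<Rightarrow> ('e set \<Rightarrow> ('e \<times> 'v) set) \<Rightarrow> bool" where
  "geometric_config G \<sigma> \<longleftrightarrow>
    cycle_orientation_config G \<sigma> \<and>
    (\<exists>r w. reference_orientation G r \<and> in_cycle_span G r w \<and>
      (\<forall>C. is_cycle G C \<longrightarrow> (\<Sum>e\<in>edges G. w e * signed_sum r (\<sigma> C) e) > 0))"

definition is_geometric_map :: "('v, 'e) ribbon \<Rightarrow> ('e set \<Rightarrow> 'v divisor) \<Rightarrow> bool" where
  "is_geometric_map G F \<longleftrightarrow>
    (\<exists>\<sigma>. geometric_config G \<sigma> \<and>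
      (\<forall>T. spanning_tree G T \<longrightarrow> F T = cycle_orientation_map G \<sigma> T))"


subsection \<open>Bernardi maps\<close>

definition starting_pair :: "('v, 'e) ribbon \<Rightarrow> 'v \<times> 'e \<Rightarrow> bool" where
  "starting_pair G s \<longleftrightarrow> s \<in> half_edges G"

definition tour_step :: "('v, 'e) ribbon \<Rightarrow> 'e set \<Rightarrow> 'v \<times> 'e \<Rightarrow> 'v \<times> 'e" where
  "tour_step G T = (\<lambda>(v, e).
    if e \<in> T then let u = other_end G e v in (u, nxt G u e) else (v, nxt G v e))"

definition tour :: "('v, 'e) ribbon \<Rightarrow> 'e set \<Rightarrow> 'v \<times> 'e \<Rightarrow> nat \<Rightarrow> 'v \<times> 'e" where
  "tour G T s i = (tour_step G T ^^ i) s"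

text \<open>
  The tour is not cut off once every edge has been traversed twice: every edge occurs before that
  moment, so its first occurrence is unaffected.
\<close>

definition first_visit :: "('v, 'e) ribbon \<Rightarrow> 'e set \<Rightarrow> 'v \<times> 'e \<Rightarrow> 'e \<Rightarrow> 'v" where
  "first_visit G T s f = fst (tour G T s (LEAST i. snd (tour G T s i) = f))"

definition bernardi :: "('v, 'e) ribbon \<Rightarrow> 'v \<times> 'e \<Rightarrow> 'e set \<Rightarrow> 'v divisor" where
  "bernardi G s T = (\<lambda>u. \<Sum>f\<in>edges G - T. chip (first_visit G T s f) u)"

end

theory Submission
  imports Defs
begin

text \<open>
  Fix a spanning tree \<open>T\<close>.  Its tour visits all half-edges cyclically, and adding a chord to an edge
  set composes the tour permutation with a transposition.  If no two chords crossed along the tour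
  of \<open>T\<close>, every added chord would split an orbit, the number of faces would be \<open>|E| - |V| + 2\<close>, and
  \<open>G\<close> would be planar.  So there are crossing chords \<open>f\<close> and \<open>g\<close>.

  Subdivide \<open>g\<close> by a vertex \<open>p\<close> and \<open>f\<close> by a vertex \<open>q\<close>, and start at \<open>p\<close>.  Extend \<open>T\<close> by one half of
  \<open>f\<close> and by either half of \<open>g\<close>.  Depending on the half of \<open>g\<close>, the tour leaves \<open>p\<close> towards one end
  of \<open>g\<close> or the other, and by crossing it meets \<open>f\<close> from opposite ends.  The missing half of \<open>f\<close> is
  thus oriented in opposite ways, which the chip at \<open>q\<close> detects.  But \<open>p\<close> is a leaf of both trees, so
  the fundamental cycle of the missing half of \<open>f\<close> is the same in both.
\<close>

subsection \<open>Orbits of a permutation composed with a transposition\<close>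

text \<open>The composed map differs from \<open>f\<close> only in exchanging the successors of
  \<open>x\<close> and \<open>y\<close>. From \<open>x\<close> it therefore runs through the whole
  orbit of \<open>y\<close>, and on leaving \<open>y\<close> it runs through the orbit of
  \<open>x\<close>.\<close>

lemma orbit_comp_transpose_merge:
  assumes f: "permutation f" and y: "y \<notin> orbit f x"
  shows "z \<in> orbit f x \<union> orbit f y \<Longrightarrow>
      orbit (f \<circ> transpose x y) z = orbit f x \<union> orbit f y"
    and "z \<notin> orbit f x \<union> orbit f y \<Longrightarrow> orbit (f \<circ> transpose x y) z = orbit f z"
proof -
  define g where "g = f \<circ> transpose x y"
  have g: "permutation g"
    using f by (simp add: g_def permutation_compose permutation_swap_id)
  have self: "w \<in> orbit f w" "w \<in> orbit g w" for w
    using f g by (auto intro: permutation_self_in_orbit)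
  have x: "x \<notin> orbit f y"
    using y self orbit_swap by metis
  have gx: "g x = f y" and gy: "g y = f x"
    by (simp_all add: g_def)
  have gz: "g w = f w" if "w \<noteq> x" "w \<noteq> y" for w
    using that by (simp add: g_def transpose_def)
  have 1: "w \<in> orbit g x" if "w \<in> orbit f y" for w
    using that
  proof induction
    case base
    then show ?case using orbit.base[of g x] gx by simp
  next
    case (step w)
    show ?case
    proof (cases "w = y")
      case True
      then show ?thesis using orbit.base[of g x] gx by simp
    next
      case False
      then have "g w = f w" using step x gz by metis
      then show ?thesis using orbit.step[OF step.IH] by simp
    qed
  qed
  have 2: "w \<in> orbit g y" if "w \<in> orbit f x" for w
    using that
  proof induction
    case base
    then show ?case using orbit.base[of g y] gy by simp
  next
    case (step w)
    show ?case
    proof (cases "w = x")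
      case True
      then show ?thesis using orbit.base[of g y] gy by simp
    next
      case False
      then have "g w = f w" using step y gz by metis
      then show ?thesis using orbit.step[OF step.IH] by simp
    qed
  qed
  have 3: "orbit g z \<subseteq> orbit f x \<union> orbit f y" if "z \<in> orbit f x \<union> orbit f y" for z
  proof
    fix w
    assume "w \<in> orbit g z"
    then show "w \<in> orbit f x \<union> orbit f y"
    proof induction
      case base
      then show ?case
        using that gx gy gz[of z] orbit.base[of f x] orbit.base[of f y] orbit.step[of z f]
        by (cases "z = x"; cases "z = y") auto
    next
      case (step w)
      then show ?case
        using gx gy gz[of w] orbit.base[of f x] orbit.base[of f y] orbit.step[of w f]
        by (cases "w = x"; cases "w = y") auto
    qed
  qed
  show "orbit (f \<circ> transpose x y) z = orbit f x \<union> orbit f y"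
    if z: "z \<in> orbit f x \<union> orbit f y"
  proof -
    have "y \<in> orbit g x" "x \<in> orbit g y"
      using 1 2 self by auto
    then have "orbit f x \<union> orbit f y \<subseteq> orbit g x" "orbit f x \<union> orbit f y \<subseteq> orbit g y"
      using 1 2 by (auto intro: orbit_trans)
    then have "orbit f x \<union> orbit f y \<subseteq> orbit g z"
      using z self(2) by (meson UnE in_mono orbit_swap orbit_trans subsetI)
    with 3[OF z] show ?thesis
      unfolding g_def by (rule subset_antisym)
  qed
  show "orbit (f \<circ> transpose x y) z = orbit f z" if "z \<notin> orbit f x \<union> orbit f y"
  proof -
    have "x \<notin> orbit f z" "y \<notin> orbit f z"
      using that self(1) orbit_swap by (metis UnCI)+
    then show ?thesis
      using orbit_cong[OF self(1), of z g] gz unfolding g_def by metis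
  qed
qed

text \<open>The orbits \<open>?X\<close> and \<open>?Y\<close> are replaced by their union; the
  other orbits, collected in \<open>R\<close>, stay as they are.\<close>

lemma card_orbits_merge:
  assumes f: "permutation f" and y: "y \<notin> orbit f x"
    and H: "finite H" "x \<in> H" "y \<in> H" "\<And>z. z \<in> H \<Longrightarrow> orbit f z \<subseteq> H"
  shows "Suc (card (orbit (f \<circ> transpose x y) ` H)) = card (orbit f ` H)"
proof -
  let ?X = "orbit f x" and ?Y = "orbit f y"
  define R where "R = orbit f ` (H - (?X \<union> ?Y))"
  have self: "w \<in> orbit f w" for w
    using f by (rule permutation_self_in_orbit)
  have eq: "orbit f w = orbit f z" if "w \<in> orbit f z" for w z
    using that self by (meson orbit_swap orbit_trans subsetI subset_antisym)
  have HU: "H = (H - (?X \<union> ?Y)) \<union> (?X \<union> ?Y)"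
    using H by blast
  have "orbit f ` (?X \<union> ?Y) = {?X, ?Y}"
  proof -
    have "orbit f ` ?X = {?X}" "orbit f ` ?Y = {?Y}"
      using eq self orbit_nonempty by (fastforce simp: image_iff)+
    then show ?thesis by (simp add: image_Un insert_commute)
  qed
  then have 1: "orbit f ` H = insert ?X (insert ?Y R)"
    by (subst HU, subst image_Un) (simp add: R_def insert_commute)
  have "orbit (f \<circ> transpose x y) ` (?X \<union> ?Y) = {?X \<union> ?Y}"
    using orbit_comp_transpose_merge(1)[OF f y] orbit_nonempty[of f x] by (auto simp: image_iff)
  moreover have "orbit (f \<circ> transpose x y) ` (H - (?X \<union> ?Y)) = R"
    unfolding R_def using orbit_comp_transpose_merge(2)[OF f y] by (intro image_cong) auto
  ultimately have 2: "orbit (f \<circ> transpose x y) ` H = insert (?X \<union> ?Y) R"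
    by (subst HU, subst image_Un) simp
  have "?X \<noteq> ?Y" using y self by blast
  moreover have "?X \<notin> R" "?Y \<notin> R" "?X \<union> ?Y \<notin> R"
    using self by (auto simp: R_def)
  moreover have "finite R" using H by (simp add: R_def)
  ultimately show ?thesis
    unfolding 1 2 by simp
qed

text \<open>Composing \<open>g\<close> with the transposition once more gives back \<open>f\<close>,
  so this is the merging lemma read backwards. It remains to see that \<open>x\<close> and
  \<open>y\<close> lie in different orbits of \<open>g\<close>.\<close>

lemma card_orbits_split:
  assumes f: "permutation f" and y: "y \<in> orbit f x" "x \<noteq> y"
    and H: "finite H" "x \<in> H" "y \<in> H" "\<And>z. z \<in> H \<Longrightarrow> f z \<in> H"
  shows "card (orbit (f \<circ> transpose x y) ` H) = Suc (card (orbit f ` H))"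
proof -
  define g where "g = f \<circ> transpose x y"
  have g: "permutation g"
    using f by (simp add: g_def permutation_compose permutation_swap_id)
  define m where "m = funpow_dist1 f x y"
  have m: "(f ^^ m) x = y" "m > 0"
    using funpow_dist1_prop[OF y(1)] by (simp_all add: m_def)
  have least: "(f ^^ k) x \<noteq> y" if "0 < k" "k < m" for k
    using funpow_dist1_least that by (simp add: m_def)
  \<comment> \<open>The arc of the \<open>f\<close>-orbit that begins right after \<open>x\<close>
    and ends at \<open>y\<close>. Since \<open>g y = f x\<close>, the map \<open>g\<close> closes
    this arc up.\<close>
  define S where "S = {(f ^^ k) x | k. 0 < k \<and> k \<le> m}"
  have xS: "x \<notin> S"
  proof
    assume "x \<in> S"
    then obtain k where "x = (f ^^ k) x" "0 < k" "k \<le> m"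
      unfolding S_def by blast
    then have k: "(f ^^ k) x = x" "0 < k" "k \<le> m"
      by simp_all
    have "k < m" using k m y by (cases "k = m") auto
    \<comment> \<open>If \<open>x\<close> recurred after \<open>k < m\<close> steps, the remaining
      \<open>m - k\<close> steps would already lead from \<open>x\<close> to \<open>y\<close>,
      against the minimality of \<open>m\<close>.\<close>
    have "(f ^^ (m - k)) x = (f ^^ (m - k)) ((f ^^ k) x)" using k by simp
    also have "\<dots> = (f ^^ (m - k + k)) x" by (simp add: funpow_add)
    also have "\<dots> = y" using m k by simp
    finally show False using least[of "m - k"] k \<open>k < m\<close> by simp
  qed
  have "w \<in> S" if "w \<in> orbit g y" for w
    using that
  proof induction
    case base
    have "g y = (f ^^ 1) x" by (simp add: g_def)
    then show ?case using m unfolding S_def by (auto intro!: exI[of _ 1])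
  next
    case (step w)
    then obtain k where k: "w = (f ^^ k) x" "0 < k" "k \<le> m" by (auto simp: S_def)
    show ?case
    proof (cases "k = m")
      case True
      then have "g w = (f ^^ 1) x" using m k by (simp add: g_def)
      then show ?thesis using m unfolding S_def by (auto intro!: exI[of _ 1])
    next
      case False
      then have "w \<noteq> x" "w \<noteq> y" using xS step least k by auto
      then have "g w = (f ^^ Suc k) x" using k by (simp add: g_def transpose_def)
      then show ?thesis using False k unfolding S_def by (auto intro!: exI[of _ "Suc k"])
    qed
  qed
  then have "x \<notin> orbit g y" using xS by blast
  then have yx: "y \<notin> orbit g x"
    using orbit_swap permutation_self_in_orbit[OF g] by metis
  have gH: "g z \<in> H" if "z \<in> H" for z
    using that H by (simp add: g_def transpose_def)
  have "orbit g z \<subseteq> H" if "z \<in> H" for z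
  proof
    fix w assume "w \<in> orbit g z"
    then show "w \<in> H" by induction (auto simp: that gH)
  qed
  from card_orbits_merge[OF g yx H(1-3) this] show ?thesis
    by (simp add: g_def comp_assoc)
qed

subsection \<open>Cycles and spanning trees\<close>

definition adj :: "('v, 'e) ribbon \<Rightarrow> 'e set \<Rightarrow> ('v \<times> 'v) set" where
  "adj G A = {(x, y). \<exists>e\<in>A. ends G e = {x, y}}"

lemma adj_iff: "(x, y) \<in> adj G A \<longleftrightarrow> (\<exists>e\<in>A. ends G e = {x, y})"
  by (simp add: adj_def)

lemma connected_by_iff:
  "connected_by G A \<longleftrightarrow> (\<forall>u\<in>verts G. \<forall>v\<in>verts G. (u, v) \<in> (adj G A)\<^sup>*)"
  by (simp add: connected_by_def adj_def)

lemma sym_adj_rtrancl: "sym ((adj G A)\<^sup>*)"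
  by (intro sym_rtrancl) (auto simp: sym_def adj_iff insert_commute)

lemma adj_rtrancl_swap: "(x, y) \<in> (adj G A)\<^sup>* \<Longrightarrow> (y, x) \<in> (adj G A)\<^sup>*"
  using sym_adj_rtrancl by (rule symD)

lemma adj_rtrancl_mono: "A \<subseteq> B \<Longrightarrow> (x, y) \<in> (adj G A)\<^sup>* \<Longrightarrow> (x, y) \<in> (adj G B)\<^sup>*"
  by (erule rtrancl_mono[THEN subsetD, rotated]) (auto simp: adj_def)

text \<open>A new edge glues the components of its two ends together and leaves all others
  alone.\<close>

lemma adj_insert_rtrancl:
  assumes "ends G e = {a, b}"
  shows "(u, v) \<in> (adj G (insert e A))\<^sup>* \<longleftrightarrow> (u, v) \<in> (adj G A)\<^sup>* \<or>
    ((u, a) \<in> (adj G A)\<^sup>* \<or> (u, b) \<in> (adj G A)\<^sup>*) \<and>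
    ((v, a) \<in> (adj G A)\<^sup>* \<or> (v, b) \<in> (adj G A)\<^sup>*)" (is "?L \<longleftrightarrow> ?R")
proof
  let ?N = "(adj G A)\<^sup>*"
  assume ?L
  then show ?R
  proof (induction rule: rtrancl_induct)
    case base
    then show ?case by simp
  next
    case (step y z)
    then consider "(y, z) \<in> adj G A" | "{y, z} = {a, b}"
      using assms by (auto simp: adj_iff)
    then show ?case
    proof cases
      case 1
      then have "(z, y) \<in> ?N" by (rule adj_rtrancl_swap[OF r_into_rtrancl])
      moreover have "(u, z) \<in> ?N" if "(u, y) \<in> ?N"
        using that 1 by (rule rtrancl.rtrancl_into_rtrancl)
      moreover have "(z, w) \<in> ?N" if "(y, w) \<in> ?N" for w
        using \<open>(z, y) \<in> ?N\<close> that by (rule rtrancl_trans)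
      ultimately show ?thesis using step.IH by metis
    next
      case 2
      then show ?thesis using step.IH by (auto simp: doubleton_eq_iff)
    qed
  qed
next
  assume ?R
  have *: "(p, q) \<in> (adj G (insert e A))\<^sup>*" if "(p, q) \<in> (adj G A)\<^sup>*" for p q
    using that adj_rtrancl_mono by (metis subset_insertI)
  have ab: "(a, b) \<in> (adj G (insert e A))\<^sup>*" "(b, a) \<in> (adj G (insert e A))\<^sup>*"
    using assms by (auto simp: adj_iff insert_commute intro!: r_into_rtrancl)
  define N where "N = (adj G (insert e A))\<^sup>*"
  have tr: "(x, z) \<in> N" if "(x, y) \<in> N" "(y, z) \<in> N" for x y z
    using that unfolding N_def by (rule rtrancl_trans)
  have sw: "(y, x) \<in> N" if "(x, y) \<in> N" for x y
    using that unfolding N_def by (rule adj_rtrancl_swap)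
  have "(u, v) \<in> N \<or> ((u, a) \<in> N \<or> (u, b) \<in> N) \<and> ((v, a) \<in> N \<or> (v, b) \<in> N)"
    using \<open>?R\<close> * unfolding N_def by blast
  then show ?L
    using ab tr sw by (fold N_def) metis
qed

section \<open>Edge cuts, cycles and paths\<close>

definition crosses :: "('v, 'e) ribbon \<Rightarrow> 'v set \<Rightarrow> 'e \<Rightarrow> bool" where
  "crosses G X e \<longleftrightarrow> ends G e \<inter> X \<noteq> {} \<and> \<not> ends G e \<subseteq> X"

text \<open>If \<open>e\<close> were the only edge of the cycle in the cut, going around the cycle
  from one end of \<open>e\<close> to the other by the remaining edges would never change
  sides.\<close>

lemma cycle_crosses_twice:
  assumes "is_cycle G C" "e \<in> C" "crosses G X e"
  shows "\<exists>e'\<in>C. e' \<noteq> e \<and> crosses G X e'"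
proof -
  obtain vs es where len: "length vs = length es" "2 \<le> length es" "distinct es"
    and en: "\<And>i. i < length es \<Longrightarrow> ends G (es ! i) = {vs ! i, vs ! (Suc i mod length es)}"
    and C: "C = fst ` {(es ! i, vs ! (Suc i mod length es)) |i. i < length es}"
    using assms unfolding is_cycle_def oriented_cycle_def by blast
  let ?n = "length es"
  have C: "C = {es ! i |i. i < ?n}" using C by force
  obtain i where i: "i < ?n" "e = es ! i" using assms C by auto
  show ?thesis
  proof (rule ccontr)
    assume neg: "\<not> ?thesis"
    have nc: "vs ! j \<in> X \<longleftrightarrow> vs ! (Suc j mod ?n) \<in> X" if "j < ?n" "j \<noteq> i" for j
    proof -
      have "es ! j \<noteq> e" using that i len by (simp add: nth_eq_iff_index_eq)
      then have "\<not> crosses G X (es ! j)" using neg that C by blast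
      then show ?thesis using en[OF that(1)] by (auto simp: crosses_def)
    qed
    have "k < ?n \<Longrightarrow> vs ! ((Suc i + k) mod ?n) \<in> X \<longleftrightarrow> vs ! (Suc i mod ?n) \<in> X" for k
    proof (induction k)
      case (Suc k)
      have "(Suc i + k) mod ?n \<noteq> i"
        using Suc.prems i(1)
        by (cases "Suc i + k < ?n") (auto simp: le_mod_geq)
      moreover have "(Suc i + k) mod ?n < ?n" using i(1) by (intro mod_less_divisor) linarith
      ultimately have "vs ! ((Suc i + k) mod ?n) \<in> X \<longleftrightarrow> vs ! (Suc ((Suc i + k) mod ?n) mod ?n) \<in> X"
        by (intro nc)
      then show ?case using Suc by (simp add: mod_Suc_eq)
    qed simp
    \<comment> \<open>From the head of edge number \<open>i\<close>, \<open>?n - 1\<close> steps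
      around the cycle lead to its tail, and none of them uses that edge.\<close>
    moreover have "Suc i + (?n - 1) = i + ?n" using i(1) by simp
    then have "(Suc i + (?n - 1)) mod ?n = i" using i(1) by (metis mod_add_self2 mod_less)
    ultimately have "vs ! i \<in> X \<longleftrightarrow> vs ! (Suc i mod ?n) \<in> X"
      using i len(2) by (metis diff_less less_le_trans pos2 zero_less_one)
    then show False using assms(3) en[OF i(1)] i(2) by (auto simp: crosses_def)
  qed
qed

lemma cycle_has_nonloop_edges:
  assumes "is_cycle G C" "e \<in> C"
  shows "e \<in> edges G" "\<not> ends G e \<subseteq> {v}"
proof -
  obtain vs es where len: "length vs = length es" "2 \<le> length es" "distinct vs"
    and en: "\<And>i. i < length es \<Longrightarrow> ends G (es ! i) = {vs ! i, vs ! (Suc i mod length es)}"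
    and C: "C = fst ` {(es ! i, vs ! (Suc i mod length es)) |i. i < length es}"
    and E: "set es \<subseteq> edges G"
    using assms unfolding is_cycle_def oriented_cycle_def by blast
  obtain i where i: "i < length es" "e = es ! i" using assms C by force
  then show "e \<in> edges G" using E by auto
  have "Suc i mod length es \<noteq> i" using i len by (auto simp: mod_Suc)
  then have "vs ! i \<noteq> vs ! (Suc i mod length es)"
    using i len mod_less_divisor[of "length es" "Suc i"]
    by (metis gr_implies_not0 nth_eq_iff_index_eq zero_less_iff_neq_zero)
  then show "\<not> ends G e \<subseteq> {v}" using en[OF i(1)] i by auto
qed

text \<open>This is the cut around the single vertex \<open>v\<close>.\<close>

lemma cycle_not_leaf:
  assumes "is_cycle G C" "e \<in> C" "v \<in> ends G e"
  shows "\<exists>e'\<in>C. e' \<noteq> e \<and> v \<in> ends G e'"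
  using cycle_crosses_twice[OF assms(1,2), of "{v}"] cycle_has_nonloop_edges[OF assms(1,2)] assms(3)
  by (auto simp: crosses_def)

text \<open>The path grows edge by edge. If the new vertex already lies on it, the path is cut off
  there instead.\<close>

lemma simple_path_exists:
  assumes "(u, v) \<in> (adj G A)\<^sup>*"
  shows "\<exists>vs es. length vs = Suc (length es) \<and> distinct vs \<and> set es \<subseteq> A \<and>
    vs ! 0 = u \<and> vs ! length es = v \<and>
    (\<forall>i<length es. ends G (es ! i) = {vs ! i, vs ! Suc i})"
  using assms
proof (induction rule: rtrancl_induct)
  case base
  show ?case by (intro exI[of _ "[u]"] exI[of _ "[]"]) simp
next
  case (step y z)
  then obtain vs es e where p: "length vs = Suc (length es)" "distinct vs" "set es \<subseteq> A"
    "vs ! 0 = u" "vs ! length es = y"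
    "\<forall>i<length es. ends G (es ! i) = {vs ! i, vs ! Suc i}" and e: "e \<in> A" "ends G e = {y, z}"
    by (auto simp: adj_iff)
  show ?case
  proof (cases "z \<in> set vs")
    case True
    then obtain k where k: "k \<le> length es" "vs ! k = z"
      using p(1) by (auto simp: in_set_conv_nth less_Suc_eq_le)
    show ?thesis
      using p k set_take_subset[of k es]
      by (intro exI[of _ "take (Suc k) vs"] exI[of _ "take k es"]) (auto dest: in_set_takeD)
  next
    case False
    show ?thesis
      using p e False
      by (intro exI[of _ "vs @ [z]"] exI[of _ "es @ [e]"]) (auto simp: nth_append less_Suc_eq)
  qed
qed

lemma cycle_through_edge:
  assumes "(u, v) \<in> (adj G A)\<^sup>*" "u \<noteq> v" "A \<subseteq> edges G"
    and h: "h \<in> edges G" "h \<notin> A" "ends G h = {u, v}"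
  shows "\<exists>C. is_cycle G C \<and> h \<in> C \<and> C \<subseteq> insert h A"
proof -
  obtain vs es where p: "length vs = Suc (length es)" "distinct vs" "set es \<subseteq> A"
    "vs ! 0 = u" "vs ! length es = v"
    and en: "\<And>i. i < length es \<Longrightarrow> ends G (es ! i) = {vs ! i, vs ! Suc i}"
    using simple_path_exists[OF assms(1)] by blast
  let ?es = "es @ [h]"
  let ?D = "{(?es ! i, vs ! (Suc i mod length ?es)) |i. i < length ?es}"
  \<comment> \<open>Equal edges have equal end sets, but distinct vertices make
    \<open>{vs ! i, vs ! Suc i}\<close> determine \<open>i\<close>.\<close>
  have "distinct es"
    unfolding distinct_conv_nth
  proof (intro allI impI)
    fix i j
    assume *: "i < length es" "j < length es" "i \<noteq> j"
    show "es ! i \<noteq> es ! j"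
    proof
      assume "es ! i = es ! j"
      then have "{vs ! i, vs ! Suc i} = {vs ! j, vs ! Suc j}" using en * by metis
      then show False
        using * p(1,2) by (auto simp: doubleton_eq_iff nth_eq_iff_index_eq)
    qed
  qed
  \<comment> \<open>Distinct ends give the path at least one edge, so the cycle closed by
    \<open>h\<close> has length at least 2.\<close>
  moreover have "es \<noteq> []" using p assms(2) by auto
  moreover have "ends G (?es ! i) = {vs ! i, vs ! (Suc i mod length ?es)}" if "i < length ?es" for i
  proof (cases "i < length es")
    case True
    then show ?thesis using en by (simp add: nth_append)
  next
    case False
    then have "i = length es" using that by simp
    then show ?thesis using p h by (simp add: insert_commute)
  qed
  ultimately have "oriented_cycle G ?D"
    unfolding oriented_cycle_def using p h assms(3)
    by (intro exI[of _ vs] exI[of _ ?es] conjI) (auto simp: Suc_le_eq)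
  moreover have "fst ` ?D = set ?es"
    by (force simp: in_set_conv_nth set_conv_nth image_iff simp del: set_append)
  ultimately show ?thesis
    unfolding is_cycle_def using p by (intro exI[of _ "set ?es"]) auto
qed

text \<open>The facts on cycles and trees involve no cyclic orders. This smaller locale makes them
  available for the subdivision without checking its rotation system.\<close>

locale multigraph =
  fixes G :: "('v, 'e) ribbon"
  assumes m_ends_verts: "e \<in> edges G \<Longrightarrow> ends G e \<subseteq> verts G"
    and m_ends_card: "e \<in> edges G \<Longrightarrow> card (ends G e) = 2"
begin

lemma edge_ends:
  assumes "e \<in> edges G" "v \<in> ends G e"
  shows "ends G e = {v, other_end G e v}" "other_end G e v \<noteq> v"
    "other_end G e (other_end G e v) = v"
proof -
  obtain a b where ab: "ends G e = {a, b}" "a \<noteq> b"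
    using m_ends_card[OF assms(1)] by (auto simp: card_2_iff)
  have "{a, b} - {a} = {b}" "{a, b} - {b} = {a}"
    using ab(2) by auto
  then have o: "other_end G e a = b" "other_end G e b = a"
    using ab(1) by (simp_all add: other_end_def)
  have "v = a \<or> v = b" using ab(1) assms(2) by simp
  then show "ends G e = {v, other_end G e v}" "other_end G e v \<noteq> v"
    "other_end G e (other_end G e v) = v"
    using ab o by (elim disjE; simp add: insert_commute)+
qed

lemma other_end_eq: "e \<in> edges G \<Longrightarrow> ends G e = {a, b} \<Longrightarrow> other_end G e a = b"
  by (metis edge_ends(1) edge_ends(2) doubleton_eq_iff insertI1)

text \<open>A path from \<open>a\<close> to \<open>b\<close> in \<open>A\<close> would close up with
  \<open>e\<close> to a cycle inside \<open>T\<close>. A general \<open>A\<close> covers both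
  \<open>T - {e}\<close> and the partial forests met when a tree is built edge by edge.\<close>

lemma tree_edge_bridge:
  assumes "spanning_tree G T" "e \<in> T" "ends G e = {a, b}" "A \<subseteq> T - {e}"
  shows "(a, b) \<notin> (adj G A)\<^sup>*"
proof
  assume ab: "(a, b) \<in> (adj G A)\<^sup>*"
  have T: "T \<subseteq> edges G" "\<And>C. is_cycle G C \<Longrightarrow> \<not> C \<subseteq> T"
    using assms(1) by (auto simp: spanning_tree_def)
  have "a \<noteq> b" using m_ends_card[of e] T assms by auto
  then obtain C where "is_cycle G C" "C \<subseteq> insert e A"
    using cycle_through_edge[OF ab, of e] T assms by blast
  then show False using T(2)[of C] assms by auto
qed

text \<open>Components supply the vertex sets to which \<open>cycle_crosses_twice\<close> is
  applied.\<close>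

lemma component_not_crossed:
  assumes "e \<in> A" "e \<in> edges G"
  shows "\<not> crosses G {z. (p, z) \<in> (adj G A)\<^sup>*} e"
proof -
  obtain r s where rs: "ends G e = {r, s}"
    using m_ends_card[OF assms(2)] by (auto simp: card_2_iff)
  then have "(r, s) \<in> adj G A" "(s, r) \<in> adj G A"
    using assms by (auto simp: adj_iff)
  then have "(p, r) \<in> (adj G A)\<^sup>* \<longleftrightarrow> (p, s) \<in> (adj G A)\<^sup>*"
    by (blast intro: rtrancl.rtrancl_into_rtrancl)
  then show ?thesis using rs by (auto simp: crosses_def)
qed

text \<open>Existence: close the tree path between the ends of \<open>h\<close>. Uniqueness: for a
  tree edge \<open>e\<close> of \<open>C\<close>, the cut between the two sides of
  \<open>T - {e}\<close> contains only \<open>e\<close> and \<open>h\<close> among the edges of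
  \<open>T + h\<close>. Every cycle in \<open>T + h\<close> passes through \<open>h\<close>, so it
  has to cross back through \<open>e\<close>.\<close>

lemma fundamental_cycle_unique:
  assumes T: "spanning_tree G T" and h: "h \<in> edges G - T"
  shows "\<exists>!C. is_cycle G C \<and> C \<subseteq> insert h T"
proof (rule ex_ex1I)
  have T': "T \<subseteq> edges G" "connected_by G T" "\<And>C. is_cycle G C \<Longrightarrow> \<not> C \<subseteq> T"
    using assms(1) by (auto simp: spanning_tree_def)
  obtain a b where ab: "ends G h = {a, b}" "a \<noteq> b"
    using m_ends_card[of h] h by (auto simp: card_2_iff)
  have "(a, b) \<in> (adj G T)\<^sup>*"
    using T'(2) m_ends_verts[of h] h ab by (auto simp: connected_by_iff)
  then show "\<exists>C. is_cycle G C \<and> C \<subseteq> insert h T"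
    using cycle_through_edge[OF _ ab(2) T'(1), of h] h ab by blast
  have sub: "C \<subseteq> D" if C: "is_cycle G C \<and> C \<subseteq> insert h T" and D: "is_cycle G D \<and> D \<subseteq> insert h T"
    for C D
  proof
    fix e
    assume e: "e \<in> C"
    have hD: "h \<in> D" using D T'(3)[of D] by auto
    show "e \<in> D"
    proof (cases "e = h")
      case False
      then have eT: "e \<in> T" using e C by auto
      obtain p q where pq: "ends G e = {p, q}"
        using m_ends_card[of e] eT T' by (auto simp: card_2_iff)
      define X where "X = {z. (p, z) \<in> (adj G (T - {e}))\<^sup>*}"
      have "p \<in> X" "q \<notin> X"
        using tree_edge_bridge[OF T eT pq order_refl] by (auto simp: X_def)
      then have "crosses G X e" using pq by (auto simp: crosses_def)
      moreover have nc: "\<not> crosses G X e'" if "e' \<in> T" "e' \<noteq> e" for e'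
        unfolding X_def using that T' by (intro component_not_crossed) auto
      ultimately have "crosses G X h"
        using cycle_crosses_twice[of G C e X] C e by blast
      then show ?thesis
        using cycle_crosses_twice[of G D h X] D hD nc by blast
    qed (use hD in simp)
  qed
  show "C = D" if "is_cycle G C \<and> C \<subseteq> insert h T" "is_cycle G D \<and> D \<subseteq> insert h T" for C D
    using sub[OF that] sub[OF that(2,1)] by blast
qed

lemma fundamental_cycle:
  assumes T: "spanning_tree G T" and h: "h \<in> edges G - T"
  shows "is_cycle G (fundamental_cycle G T h)" "fundamental_cycle G T h \<subseteq> insert h T"
    "h \<in> fundamental_cycle G T h"
proof -
  let ?C = "fundamental_cycle G T h"
  have *: "is_cycle G ?C \<and> ?C \<subseteq> insert h T"
    unfolding fundamental_cycle_def by (rule theI'[OF fundamental_cycle_unique[OF assms]])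
  then show "is_cycle G ?C" "?C \<subseteq> insert h T" by auto
  show "h \<in> ?C" using * T unfolding spanning_tree_def by blast
qed

lemma head_in_ends:
  assumes D: "oriented_cycle G D" and h: "h \<in> fst ` D"
  shows "head_in D h \<in> ends G h"
proof -
  obtain vs es where len: "distinct es"
    and en: "\<And>i. i < length es \<Longrightarrow> ends G (es ! i) = {vs ! i, vs ! (Suc i mod length es)}"
    and D: "D = {(es ! i, vs ! (Suc i mod length es)) |i. i < length es}"
    using D unfolding oriented_cycle_def by blast
  obtain i where i: "i < length es" "h = es ! i" using h D by force
  have "head_in D h = vs ! (Suc i mod length es)"
    unfolding head_in_def
  proof (rule the_equality)
    show "(h, vs ! (Suc i mod length es)) \<in> D" using i D by blast
    fix v assume "(h, v) \<in> D"
    then obtain j where "j < length es" "h = es ! j" "v = vs ! (Suc j mod length es)"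
      using D by blast
    then show "v = vs ! (Suc i mod length es)" using i len by (simp add: nth_eq_iff_index_eq)
  qed
  then show ?thesis using en[OF i(1)] i by simp
qed

text \<open>An edge \<open>e\<close> of a cycle in \<open>T\<close> could be deleted: if its ends
  fell apart in \<open>T - {e}\<close>, the cycle would cross the resulting cut only once.\<close>

lemma minimal_connected_is_tree:
  assumes T: "T \<subseteq> edges G" "connected_by G T" and min: "\<And>S. S \<subset> T \<Longrightarrow> \<not> connected_by G S"
  shows "spanning_tree G T"
  unfolding spanning_tree_def
proof (intro conjI T allI impI notI)
  fix C
  assume C: "is_cycle G C" "C \<subseteq> T"
  obtain e where e: "e \<in> C"
    using C(1) by (force simp: is_cycle_def oriented_cycle_def)
  obtain p q where pq: "ends G e = {p, q}"
    using m_ends_card[of e] e C T by (auto simp: card_2_iff)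
  define X where "X = {z. (p, z) \<in> (adj G (T - {e}))\<^sup>*}"
  have nc: "\<not> crosses G X e'" if "e' \<in> T" "e' \<noteq> e" for e'
    unfolding X_def using that T by (intro component_not_crossed) auto
  have "q \<in> X"
  proof (rule ccontr)
    assume "q \<notin> X"
    then have "crosses G X e" using pq by (auto simp: crosses_def X_def)
    then show False using cycle_crosses_twice[OF C(1) e] nc C by blast
  qed
  then have pq': "(p, q) \<in> (adj G (T - {e}))\<^sup>*" by (simp add: X_def)
  have eT: "e \<in> T" using e C by auto
  have "connected_by G (T - {e})"
    unfolding connected_by_iff
  proof (intro ballI)
    fix u v
    assume "u \<in> verts G" "v \<in> verts G"
    then have "(u, v) \<in> (adj G (insert e (T - {e})))\<^sup>*"
      using T(2) eT by (simp add: connected_by_iff insert_absorb)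
    moreover define N where "N = (adj G (T - {e}))\<^sup>*"
    moreover have "(x, z) \<in> N" if "(x, y) \<in> N" "(y, z) \<in> N" for x y z
      using that unfolding N_def by (rule rtrancl_trans)
    moreover have "(y, x) \<in> N" if "(x, y) \<in> N" for x y
      using that unfolding N_def by (rule adj_rtrancl_swap)
    ultimately show "(u, v) \<in> (adj G (T - {e}))\<^sup>*"
      unfolding adj_insert_rtrancl[OF pq] using pq' by (fold N_def) metis
  qed
  then show False using min[of "T - {e}"] eT by blast
qed

lemma spanning_tree_exists:
  assumes "finite (edges G)" "connected_by G (edges G)"
  shows "\<exists>T. spanning_tree G T"
proof -
  let ?P = "\<lambda>S. S \<subseteq> edges G \<and> connected_by G S"
  obtain T where T: "?P T" "\<And>S. ?P S \<Longrightarrow> card T \<le> card S"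
    using ex_has_least_nat[of ?P "edges G" card] assms(2) by blast
  have "\<not> connected_by G S" if "S \<subset> T" for S
  proof
    assume "connected_by G S"
    then have "card T \<le> card S" using T that by auto
    moreover have "card S < card T"
      using psubset_card_mono[OF _ that] T(1) assms(1) finite_subset by blast
    ultimately show False by simp
  qed
  then show ?thesis using minimal_connected_is_tree T(1) by blast
qed

end

subsection \<open>Tours and faces\<close>

text \<open>An inductive form of the first occurrence of \<open>f\<close>. It replaces the least
  index in \<open>first_visit\<close>, so that tours in different graphs can be compared by rule
  induction although they take different numbers of steps. It holds only if \<open>f\<close> is met
  at all.\<close>

inductive visits :: "('v \<times> 'e \<Rightarrow> 'v \<times> 'e) \<Rightarrow> 'e \<Rightarrow> 'v \<times> 'e \<Rightarrow> 'v \<Rightarrow> bool" for step f where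
  here: "snd s = f \<Longrightarrow> visits step f s (fst s)"
| later: "snd s \<noteq> f \<Longrightarrow> visits step f (step s) v \<Longrightarrow> visits step f s v"

lemma visits_here_iff: "snd s = f \<Longrightarrow> visits step f s v \<longleftrightarrow> v = fst s"
  by (auto intro: visits.here elim: visits.cases)

lemma visits_later_iff: "snd s \<noteq> f \<Longrightarrow> visits step f s v \<longleftrightarrow> visits step f (step s) v"
  by (auto intro: visits.later elim: visits.cases)

lemma visits_first_visit: "visits (tour_step G T) f s v \<Longrightarrow> first_visit G T s f = v"
proof (induction rule: visits.induct)
  case (here s)
  then have "(LEAST i. snd (tour G T s i) = f) = 0"
    by (intro Least_eq_0) (simp add: tour_def)
  then show ?case by (simp add: first_visit_def tour_def)
next
  case (later s v)
  have eq: "tour G T s (Suc i) = tour G T (tour_step G T s) i" for i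
    by (simp add: tour_def funpow_swap1)
  obtain n where "snd (tour G T (tour_step G T s) n) = f"
  proof -
    have "\<exists>n. snd (tour G T (tour_step G T s) n) = f"
      using later(2)
    proof (induction rule: visits.induct)
      case (here s)
      then show ?case by (intro exI[of _ 0]) (simp add: tour_def)
    next
      case (later s v)
      then obtain n where "snd (tour G T (tour_step G T s) n) = f" by blast
      then show ?case by (intro exI[of _ "Suc n"]) (simp add: tour_def funpow_swap1)
    qed
    then show thesis using that by blast
  qed
  \<comment> \<open>Shifting the least index by one requires that \<open>f\<close> does occur, which
    \<open>n\<close> witnesses.\<close>
  then have "(LEAST i. snd (tour G T s i) = f) = Suc (LEAST i. snd (tour G T s (Suc i)) = f)"
    using later(1) by (intro Least_Suc[where n = "Suc n"]) (simp_all add: eq, simp add: tour_def)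
  then show ?case
    using later.IH by (simp add: first_visit_def eq)
qed

text \<open>The vertex may change: on the way from \<open>s\<close> to \<open>t\<close> the edge
  \<open>f\<close> may be met earlier, at its other end.\<close>

lemma visits_from_orbit:
  assumes "t \<in> orbit step s" "visits step f t v"
  shows "\<exists>w. visits step f s w"
proof -
  have 1: "\<exists>w. visits step f s w" if "visits step f (step s) v" for s v
    using that by (cases "snd s = f") (auto simp: visits_here_iff visits_later_iff)
  show ?thesis
    using assms
  proof (induction arbitrary: v rule: orbit.induct)
    case base
    then show ?case using 1 by blast
  next
    case (step y)
    then show ?case using 1 by blast
  qed
qed

lemma cyclic_on_inj_on:
  assumes "cyclic_on f S"
  shows "inj_on f S"
proof -
  have "S \<subseteq> f ` S"
  proof
    fix y assume "y \<in> S"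
    then obtain s where "s \<in> S" "S = orbit f s" "y \<in> orbit f s"
      using assms by (auto simp: cyclic_on_def)
    then show "y \<in> f ` S" by (auto elim: orbit.cases)
  qed
  moreover have "f ` S \<subseteq> S" using cyclic_on_inI[OF assms] by blast
  ultimately have "f ` S = S" by blast
  then show ?thesis
    using finite_cyclic_on[OF assms] by (intro eq_card_imp_inj_on) simp_all
qed

lemma half_edges_iff: "(v, e) \<in> half_edges G \<longleftrightarrow> e \<in> edges G \<and> v \<in> ends G e"
  by (simp add: half_edges_def)

sublocale ribbon_graph \<subseteq> multigraph
  by unfold_locales (rule ends_verts, assumption, rule ends_card)

section \<open>The tour permutation of an edge set and its orbits\<close>

context ribbon_graph
begin

text \<open>The restriction makes the step the identity off the half-edges, hence a genuine
  permutation. On half-edges, the empty set gives the rotation around vertices and the full edge set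
  gives the face permutation.\<close>

definition tour_perm :: "'e set \<Rightarrow> 'v \<times> 'e \<Rightarrow> 'v \<times> 'e" where
  "tour_perm A = perm_restrict (tour_step G A) (half_edges G)"

lemma finite_half_edges: "finite (half_edges G)"
proof -
  have "half_edges G \<subseteq> verts G \<times> edges G"
    using ends_verts by (auto simp: half_edges_def)
  then show ?thesis using finite_verts finite_edges finite_subset by blast
qed

lemma cyclic_incident:
  assumes "(v, e) \<in> half_edges G"
  shows "cyclic_on (nxt G v) (incident G v)" "e \<in> incident G v"
proof -
  show "e \<in> incident G v" using assms by (simp add: half_edges_iff incident_def)
  then show "cyclic_on (nxt G v) (incident G v)"
    using assms ends_verts by (intro nxt_cyclic) (auto simp: half_edges_iff)
qed

lemma half_edge_vert: "h \<in> half_edges G \<Longrightarrow> fst h \<in> verts G"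
  using ends_verts by (cases h) (auto simp: half_edges_iff)

lemma nxt_half_edge: "(v, e) \<in> half_edges G \<Longrightarrow> (v, nxt G v e) \<in> half_edges G"
  using cyclic_on_inI[OF cyclic_incident] by (auto simp: half_edges_iff incident_def)

lemma other_end_half_edge:
  assumes "(v, e) \<in> half_edges G"
  shows "(other_end G e v, e) \<in> half_edges G"
  using assms edge_ends(1)[of e v] by (auto simp: half_edges_iff)

lemma tour_step_half_edge: "h \<in> half_edges G \<Longrightarrow> tour_step G A h \<in> half_edges G"
  by (cases h) (auto simp: tour_step_def Let_def nxt_half_edge other_end_half_edge)

lemma tour_perm_empty_permutes: "tour_perm {} permutes half_edges G"
proof -
  have "inj_on (tour_step G {}) (half_edges G)"
  proof (rule inj_onI, clarify)
    fix v e w d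
    assume h: "(v, e) \<in> half_edges G" "(w, d) \<in> half_edges G"
      and "tour_step G {} (v, e) = tour_step G {} (w, d)"
    then have vw: "v = w" "nxt G v e = nxt G v d" by (auto simp: tour_step_def)
    have "inj_on (nxt G v) (incident G v)"
      using cyclic_on_inj_on cyclic_incident[OF h(1)] by blast
    then show "v = w \<and> e = d"
      using vw cyclic_incident(2)[OF h(1)] cyclic_incident(2)[OF h(2)] by (auto dest: inj_onD)
  qed
  then have "bij_betw (tour_step G {}) (half_edges G) (half_edges G)"
    using tour_step_half_edge finite_half_edges
    by (intro bij_betw_imageI endo_inj_surj) auto
  then have "bij_betw (tour_perm {}) (half_edges G) (half_edges G)"
    by (rule bij_betw_cong[THEN iffD1, rotated]) (simp add: tour_perm_def perm_restrict_def)
  then show ?thesis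
    by (rule bij_imp_permutes) (simp add: tour_perm_def perm_restrict_def)
qed

text \<open>With \<open>e\<close> in the set, the tour at \<open>(a, e)\<close> moves to
  \<open>b\<close> and turns there exactly as it did before at \<open>(b, e)\<close>, and vice
  versa.\<close>

lemma tour_perm_insert:
  assumes "e \<in> edges G - A" "ends G e = {a, b}"
  shows "tour_perm (insert e A) = tour_perm A \<circ> transpose (a, e) (b, e)"
proof
  fix h :: "'v \<times> 'e"
  obtain v d where h: "h = (v, d)" by (cases h)
  have o: "other_end G e a = b" "other_end G e b = a"
    using other_end_eq[of e a b] other_end_eq[of e b a] assms by (auto simp: insert_commute)
  have H: "(a, e) \<in> half_edges G" "(b, e) \<in> half_edges G"
    using assms by (auto simp: half_edges_iff)
  consider "h = (a, e)" | "h = (b, e)" | "h \<in> half_edges G" "d \<noteq> e" | "h \<notin> half_edges G"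
    using assms h by (auto simp: half_edges_iff)
  then show "tour_perm (insert e A) h = (tour_perm A \<circ> transpose (a, e) (b, e)) h"
  proof cases
    case 3
    then have "transpose (a, e) (b, e) h = h" by (auto simp: transpose_def h)
    then show ?thesis using 3 by (simp add: tour_perm_def perm_restrict_def tour_step_def h)
  next
    case 4
    then have "transpose (a, e) (b, e) h = h" using H by (auto simp: transpose_def)
    then show ?thesis using 4 by (simp add: tour_perm_def perm_restrict_def)
  qed (use assms o H in \<open>auto simp: tour_perm_def perm_restrict_def tour_step_def\<close>)
qed

lemma tour_perm_permutes:
  assumes "A \<subseteq> edges G"
  shows "tour_perm A permutes half_edges G"
  using finite_subset[OF assms finite_edges] assms
proof (induction rule: finite_induct)
  case empty
  show ?case by (rule tour_perm_empty_permutes)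
next
  case (insert e A)
  then obtain a b where ab: "ends G e = {a, b}"
    using ends_card[of e] by (auto simp: card_2_iff)
  then have "(a, e) \<in> half_edges G" "(b, e) \<in> half_edges G"
    using insert by (auto simp: half_edges_iff)
  then show ?case
    using insert ab tour_perm_insert[of e A a b]
    by (metis Diff_iff insert_subset permutes_compose permutes_swap_id)
qed

lemma tour_perm_permutation: "A \<subseteq> edges G \<Longrightarrow> permutation (tour_perm A)"
  using tour_perm_permutes finite_half_edges permutation_permutes by blast

lemma tour_perm_orbit_subset: "A \<subseteq> edges G \<Longrightarrow> h \<in> half_edges G \<Longrightarrow> orbit (tour_perm A) h \<subseteq> half_edges G"
  using tour_perm_permutes permutes_orbit_subset by metis

lemma orbit_tour_step:
  assumes "h \<in> half_edges G"
  shows "orbit (tour_step G A) h = orbit (tour_perm A) h"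
  using assms
  by (intro orbit_cong0[where A = "half_edges G"])
    (auto simp: tour_step_half_edge tour_perm_def perm_restrict_def)

definition num_orbits :: "'e set \<Rightarrow> nat" where
  "num_orbits A = card (orbit (tour_perm A) ` half_edges G)"

lemma num_faces_eq:
  assumes "edges G \<noteq> {}"
  shows "num_faces G = num_orbits (edges G)"
proof -
  have "orbit (face_perm G) h = orbit (tour_perm (edges G)) h" if h: "h \<in> half_edges G" for h
  proof -
    have "face_perm G h = tour_step G (edges G) h" if "h \<in> half_edges G" for h
      using that by (auto simp: face_perm_def tour_step_def half_edges_def)
    then have "orbit (tour_step G (edges G)) h = orbit (face_perm G) h"
      using h by (intro orbit_cong0[where A = "half_edges G"]) (auto simp: tour_step_half_edge)
    then show ?thesis using orbit_tour_step[OF h] by simp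
  qed
  then show ?thesis using assms by (simp add: num_faces_def num_orbits_def cong: image_cong)
qed

lemma orbit_tour_perm_empty:
  assumes "(v, e) \<in> half_edges G"
  shows "orbit (tour_perm {}) (v, e) = {v} \<times> incident G v"
proof -
  have "(\<lambda>d. (v, d)) ` orbit (nxt G v) e = orbit (tour_step G {}) (v, e)"
    using cyclic_incident[OF assms]
    by (intro orbit_inverse) (auto simp: tour_step_def cyclic_on_alldef)
  moreover have "orbit (nxt G v) e = incident G v"
    using cyclic_incident[OF assms] by (simp add: cyclic_on_alldef)
  moreover have "Pair v ` incident G v = {v} \<times> incident G v"
    by auto
  ultimately show ?thesis
    using orbit_tour_step[OF assms] by simp
qed

text \<open>Lets orbits be counted by vertices: each vertex carries an orbit of
  \<open>tour_perm {}\<close>.\<close>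

lemma incident_nonempty:
  assumes "edges G \<noteq> {}" "v \<in> verts G"
  shows "incident G v \<noteq> {}"
proof -
  obtain e where e: "e \<in> edges G" using assms by blast
  then have "\<not> ends G e \<subseteq> {v}" using ends_card[OF e] card_mono[of "{v}" "ends G e"] by auto
  then obtain w where w: "w \<in> verts G" "w \<noteq> v" using ends_verts[OF e] by blast
  then have "(v, w) \<in> (adj G (edges G))\<^sup>*" using connected assms by (simp add: connected_by_iff)
  then obtain z where "(v, z) \<in> adj G (edges G)" using w by (metis converse_rtranclE)
  then show ?thesis by (auto simp: adj_iff incident_def)
qed

text \<open>Induction along the tree edges. Each new edge is a bridge, so its half-edges lie in
  different orbits and these merge. The description of orbits by components is carried along to
  recognise this at the next edge.\<close>

lemma forest_orbits:
  assumes T: "spanning_tree G T" and ne: "edges G \<noteq> {}" and A: "A \<subseteq> T"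
  shows "(\<forall>g\<in>half_edges G. \<forall>h\<in>half_edges G.
      h \<in> orbit (tour_perm A) g \<longleftrightarrow> (fst g, fst h) \<in> (adj G A)\<^sup>*) \<and>
    num_orbits A + card A = card (verts G)"
proof -
  have TE: "T \<subseteq> edges G" using T by (simp add: spanning_tree_def)
  have "finite A" using A TE finite_edges by (meson finite_subset)
  then show ?thesis
    using A
  proof (induction rule: finite_induct)
    case empty
    have "(adj G {})\<^sup>* = Id" by (simp add: adj_def)
    then have 1: "h \<in> orbit (tour_perm {}) g \<longleftrightarrow> (fst g, fst h) \<in> (adj G {})\<^sup>*"
      if "g \<in> half_edges G" "h \<in> half_edges G" for g h
      using that orbit_tour_perm_empty[of "fst g" "snd g"] cyclic_incident(2)[of "fst h" "snd h"]
      by (auto simp: mem_Times_iff)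
    have "orbit (tour_perm {}) ` half_edges G = (\<lambda>v. {v} \<times> incident G v) ` verts G" (is "?L = ?R")
    proof (intro equalityI subsetI)
      fix X assume "X \<in> ?L"
      then obtain v e where "(v, e) \<in> half_edges G" "X = orbit (tour_perm {}) (v, e)" by auto
      then show "X \<in> ?R" using orbit_tour_perm_empty half_edge_vert by fastforce
    next
      fix X assume "X \<in> ?R"
      then obtain v where v: "v \<in> verts G" "X = {v} \<times> incident G v" by auto
      then obtain e where "e \<in> incident G v" using incident_nonempty[OF ne] by blast
      then have "(v, e) \<in> half_edges G" by (simp add: half_edges_iff incident_def)
      then show "X \<in> ?L" using v orbit_tour_perm_empty by force
    qed
    moreover have "inj_on (\<lambda>v. {v} \<times> incident G v) (verts G)"
      using incident_nonempty[OF ne] by (auto simp: inj_on_def times_eq_iff)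
    ultimately show ?case using 1 by (simp add: num_orbits_def card_image)
  next
    case (insert e A)
    have e: "e \<in> edges G" "e \<notin> A" using insert TE by auto
    have AE: "A \<subseteq> edges G" using insert TE by auto
    obtain a b where ab: "ends G e = {a, b}"
      using ends_card[of e] e by (auto simp: card_2_iff)
    let ?x = "(a, e)" and ?y = "(b, e)" and ?f = "tour_perm A"
    have xy: "?x \<in> half_edges G" "?y \<in> half_edges G"
      using e ab by (auto simp: half_edges_iff)
    have IH: "h \<in> orbit ?f g \<longleftrightarrow> (fst g, fst h) \<in> (adj G A)\<^sup>*"
      if "g \<in> half_edges G" "h \<in> half_edges G" for g h
      using insert that by auto
    have "(a, b) \<notin> (adj G A)\<^sup>*"
      using tree_edge_bridge[OF T _ ab, of A] insert by auto
    then have y: "?y \<notin> orbit ?f ?x" using IH[OF xy] by simp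
    have f: "permutation ?f" by (rule tour_perm_permutation[OF AE])
    have g: "tour_perm (insert e A) = ?f \<circ> transpose ?x ?y"
      using tour_perm_insert e ab by blast
    have "Suc (num_orbits (insert e A)) = num_orbits A"
      unfolding num_orbits_def g
      using card_orbits_merge[OF f y finite_half_edges xy] tour_perm_orbit_subset[OF AE] by blast
    moreover have "num_orbits A + card A = card (verts G)" using insert by auto
    moreover have "h \<in> orbit (tour_perm (insert e A)) g \<longleftrightarrow> (fst g, fst h) \<in> (adj G (insert e A))\<^sup>*"
      if gh: "g \<in> half_edges G" "h \<in> half_edges G" for g h
    proof -
      have sw: "(u, v) \<in> (adj G A)\<^sup>* \<longleftrightarrow> (v, u) \<in> (adj G A)\<^sup>*" for u v
        using adj_rtrancl_swap by metis
      have "k \<in> orbit ?f ?x \<union> orbit ?f ?y \<longleftrightarrow>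
          (fst k, a) \<in> (adj G A)\<^sup>* \<or> (fst k, b) \<in> (adj G A)\<^sup>*" if "k \<in> half_edges G" for k
        using IH[OF xy(1) that] IH[OF xy(2) that] sw by simp
      moreover have "(fst k, a) \<in> (adj G A)\<^sup>* \<or> (fst k, b) \<in> (adj G A)\<^sup>* \<Longrightarrow>
        (fst k, fst l) \<in> (adj G A)\<^sup>* \<Longrightarrow> (fst l, a) \<in> (adj G A)\<^sup>* \<or> (fst l, b) \<in> (adj G A)\<^sup>*" for k l :: "'v \<times> 'e"
        using sw[of "fst k" "fst l"] by (auto intro: rtrancl_trans)
      ultimately show ?thesis
        unfolding g adj_insert_rtrancl[OF ab]
        using orbit_comp_transpose_merge[OF f y, of g] gh IH[OF gh] by (metis (lifting))
    qed
    ultimately show ?case using insert by auto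
  qed
qed

lemma tree_orbit:
  assumes T: "spanning_tree G T" and "g \<in> half_edges G" "h \<in> half_edges G"
  shows "h \<in> orbit (tour_step G T) g"
proof -
  have ne: "edges G \<noteq> {}" using assms(2) by (auto simp: half_edges_def)
  have "fst g \<in> verts G" "fst h \<in> verts G"
    using assms half_edge_vert by auto
  then have "(fst g, fst h) \<in> (adj G T)\<^sup>*"
    using T by (simp add: spanning_tree_def connected_by_iff)
  then show ?thesis
    using forest_orbits[OF T ne order_refl] assms orbit_tour_step by simp
qed

lemma tree_count:
  assumes T: "spanning_tree G T" and ne: "edges G \<noteq> {}"
  shows "num_orbits T = 1" "Suc (card T) = card (verts G)"
proof -
  obtain h where h: "h \<in> half_edges G"
  proof -
    obtain e where e: "e \<in> edges G" using ne by blast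
    then obtain v where "v \<in> ends G e" using ends_card[OF e] by fastforce
    then show thesis using that[of "(v, e)"] e by (simp add: half_edges_iff)
  qed
  have TE: "T \<subseteq> edges G" using T by (simp add: spanning_tree_def)
  have "orbit (tour_perm T) g = half_edges G" if "g \<in> half_edges G" for g
    using tree_orbit[OF T that] tour_perm_orbit_subset[OF TE that] orbit_tour_step[OF that] by blast
  then have "orbit (tour_perm T) ` half_edges G = {half_edges G}"
    using h by auto
  then show 1: "num_orbits T = 1" by (simp add: num_orbits_def)
  show "Suc (card T) = card (verts G)"
    using forest_orbits[OF T ne order_refl] 1 by simp
qed

lemma tree_visits:
  assumes "spanning_tree G T" "h \<in> half_edges G" "f \<in> edges G"
  shows "\<exists>v. visits (tour_step G T) f h v"
proof -
  obtain v where "v \<in> ends G f" using ends_card[OF assms(3)] by fastforce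
  then have "(v, f) \<in> orbit (tour_step G T) h"
    using tree_orbit[OF assms(1,2)] assms(3) by (simp add: half_edges_iff)
  then show ?thesis
    using visits.here[of "(v, f)" f] visits_from_orbit by fastforce
qed

lemma visits_end:
  assumes "visits (tour_step G T) f h v" "h \<in> half_edges G"
  shows "v \<in> ends G f"
  using assms
proof (induction rule: visits.induct)
  case (here s)
  then show ?case by (cases s) (simp add: half_edges_iff)
next
  case (later s v)
  then show ?case using tour_step_half_edge by blast
qed

section \<open>Crossing chords and planarity\<close>

text \<open>The half-edges of \<open>f\<close> and of \<open>g\<close> alternate in the cyclic order of the tour of \<open>T\<close>.\<close>

definition crossing :: "'e set \<Rightarrow> 'e \<Rightarrow> 'e \<Rightarrow> bool" where
  "crossing T f g \<longleftrightarrow> (\<exists>c d v w. ends G g = {c, d} \<and> v \<noteq> w \<and>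
    visits (tour_step G T) f (c, g) v \<and> visits (tour_step G T) f (d, g) w)"

text \<open>Colour a half-edge by the end of \<open>f\<close> that the tour of \<open>T\<close>
  meets first from there. Chords that do not cross \<open>f\<close> join half-edges of equal colour,
  so the tour of \<open>T \<union> B\<close> leaving \<open>(a, f)\<close> keeps the colour
  \<open>b\<close> until it meets \<open>f\<close>, which then happens at \<open>b\<close>.\<close>

lemma noncrossing_same_orbit:
  assumes T: "spanning_tree G T" and f: "f \<in> edges G - T" "ends G f = {a, b}"
    and B: "B \<subseteq> edges G - T" "f \<notin> B" and nc: "\<And>g. g \<in> B \<Longrightarrow> \<not> crossing T f g"
  shows "(b, f) \<in> orbit (tour_perm (T \<union> B)) (a, f)"
proof -
  let ?p = "tour_step G T" and ?q = "tour_step G (T \<union> B)"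
  let ?x = "(a, f)" and ?y = "(b, f)"
  have xy: "?x \<in> half_edges G" "?y \<in> half_edges G"
    using f by (auto simp: half_edges_iff)
  have TB: "T \<union> B \<subseteq> edges G" using B T by (auto simp: spanning_tree_def)
  have "a \<noteq> b" using ends_card[of f] f by auto
  have px: "?p ?x \<in> half_edges G" by (rule tour_step_half_edge[OF xy(1)])
  have bvis: "visits ?p f (?p ?x) b"
  proof -
    obtain w where w: "visits ?p f (?p ?x) w"
      using tree_visits[OF T px] f by blast
    have "w \<noteq> a"
    proof
      assume "w = a"
      \<comment> \<open>If the tour of \<open>T\<close> returned to \<open>a\<close> first, all of
        its orbit would have colour \<open>a\<close>, including \<open>(b, f)\<close>.\<close>
      have "visits ?p f z a" if "z \<in> orbit ?p ?x" for z
        using that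
      proof induction
        case base
        show ?case using w \<open>w = a\<close> by simp
      next
        case (step z)
        show ?case
        proof (cases "snd z = f")
          case True
          then have "z = ?x" using step.IH by (simp add: visits_here_iff prod_eq_iff)
          then show ?thesis using w \<open>w = a\<close> by simp
        next
          case False
          then show ?thesis using step.IH by (simp add: visits_later_iff)
        qed
      qed
      from this[OF tree_orbit[OF T xy]] show False
        using \<open>a \<noteq> b\<close> by (simp add: visits_here_iff)
    qed
    then show ?thesis using w visits_end[OF w px] f by auto
  qed
  txt \<open>Jumping along a chord that does not cross \<open>f\<close> does not change which end of \<open>f\<close> comes next.\<close>
  have inv: "visits ?p f (?q z) b" if z: "z \<in> half_edges G" "snd z \<noteq> f" "visits ?p f z b" for z
  proof -
    obtain v e where ve: "z = (v, e)" by (cases z)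
    have zb: "visits ?p f (?p z) b" using z by (simp add: visits_later_iff)
    show ?thesis
    proof (cases "e \<in> B")
      case True
      define u where "u = other_end G e v"
      have e: "e \<in> edges G" "v \<in> ends G e" using z ve by (auto simp: half_edges_iff)
      have u: "ends G e = {v, u}" using edge_ends[OF e] by (simp add: u_def)
      have "(u, e) \<in> half_edges G" using z(1) ve other_end_half_edge u_def by simp
      then obtain w where w: "visits ?p f (u, e) w" using tree_visits[OF T] f by blast
      then have "w = b" using nc[OF True] u z(3) ve unfolding crossing_def by blast
      then have "visits ?p f (?p (u, e)) b"
        using w z(2) ve by (simp add: visits_later_iff)
      \<comment> \<open>At a chord in \<open>B\<close> the new tour continues as the tour of
        \<open>T\<close> does from the opposite half-edge.\<close>
      moreover have "?q z = ?p (u, e)"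
        using True B by (auto simp: tour_step_def ve u_def Let_def)
      ultimately show ?thesis by simp
    next
      case False
      then have "?q z = ?p z" by (simp add: tour_step_def ve)
      then show ?thesis using zb by simp
    qed
  qed
  have "visits ?p f z b \<or> ?y \<in> orbit ?q ?x" if "z \<in> orbit ?q ?x" for z
    using that
  proof induction
    case base
    have "?q ?x = ?p ?x" using f B by (auto simp: tour_step_def)
    then show ?case using bvis by simp
  next
    case (step z)
    have "z \<in> half_edges G"
      using step.hyps orbit_tour_step[OF xy(1)] tour_perm_orbit_subset[OF TB xy(1)] by auto
    then show ?case
      using step inv[of z] by (cases "snd z = f") (auto simp: visits_here_iff prod_eq_iff)
  qed
  \<comment> \<open>The orbit returns to \<open>?x\<close>, whose colour is \<open>a\<close> and not
    \<open>b\<close>; hence \<open>?y\<close> was met.\<close>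
  moreover have "?x \<in> orbit ?q ?x"
    using permutation_self_in_orbit[OF tour_perm_permutation[OF TB]] orbit_tour_step[OF xy(1)] by simp
  ultimately have "?y \<in> orbit ?q ?x"
    using \<open>a \<noteq> b\<close> by (force simp: visits_here_iff)
  then show ?thesis using orbit_tour_step[OF xy(1)] by simp
qed

lemma crossing_exists:
  assumes "\<not> planar G" "spanning_tree G T"
  shows "\<exists>f\<in>edges G - T. \<exists>g\<in>edges G - T. f \<noteq> g \<and> crossing T f g"
proof (rule ccontr)
  assume nc: "\<not> ?thesis"
  have TE: "T \<subseteq> edges G" using assms(2) by (simp add: spanning_tree_def)
  \<comment> \<open>A connected graph without edges is a single vertex, and its face count is 1 by
    convention.\<close>
  have ne: "edges G \<noteq> {}"
  proof
    assume e: "edges G = {}"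
    then have eq: "u = v" if "u \<in> verts G" "v \<in> verts G" for u v
      using connected that by (simp add: connected_by_def)
    obtain v where v: "v \<in> verts G" using verts_nonempty by blast
    have "verts G \<subseteq> {v}" using eq[OF _ v] by blast
    then have "verts G = {v}" using v by blast
    then show False using e assms(1) by (simp add: planar_def euler_char_def num_faces_def)
  qed
  have "num_orbits (T \<union> B) = Suc (card B)" if "B \<subseteq> edges G - T" for B
    using finite_subset[OF that finite_Diff[OF finite_edges]] that
  proof (induction B rule: finite_induct)
    case empty
    then show ?case using tree_count[OF assms(2) ne] by simp
  next
    case (insert f B)
    have f: "f \<in> edges G - T" using insert by auto
    have TB: "T \<union> B \<subseteq> edges G" using insert TE by auto
    obtain a b where ab: "ends G f = {a, b}" "a \<noteq> b"
      using ends_card[of f] f by (auto simp: card_2_iff)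
    have xy: "(a, f) \<in> half_edges G" "(b, f) \<in> half_edges G"
      using f ab by (auto simp: half_edges_iff)
    have "(b, f) \<in> orbit (tour_perm (T \<union> B)) (a, f)"
    proof (rule noncrossing_same_orbit[OF assms(2) f ab(1)])
      show "\<not> crossing T f g" if "g \<in> B" for g
        using that nc insert f by (metis insert_subset subsetD)
    qed (use insert in auto)
    then have "num_orbits (insert f (T \<union> B)) = Suc (num_orbits (T \<union> B))"
      using card_orbits_split[OF tour_perm_permutation[OF TB] _ _ finite_half_edges xy]
        tour_perm_insert[of f "T \<union> B" a b] permutes_in_image[OF tour_perm_permutes[OF TB]] ab insert f
      by (auto simp: num_orbits_def)
    then show ?case using insert by simp
  qed
  from this[of "edges G - T"] have "num_orbits (edges G) = Suc (card (edges G - T))"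
    using TE by (simp add: Un_absorb1)
  moreover have "card (edges G - T) + card T = card (edges G)"
    using card_Diff_subset[of T "edges G"] card_mono[OF finite_edges TE] finite_subset[OF TE finite_edges] TE by simp
  \<comment> \<open>With \<open>card T = card (verts G) - 1\<close> the face count yields Euler
    characteristic 2.\<close>
  ultimately show False
    using assms(1) tree_count(2)[OF assms(2) ne] num_faces_eq[OF ne]
    by (simp add: planar_def euler_char_def)
qed

end

subsection \<open>Lifting tours to a subdivision\<close>

text \<open>Tree edges stay whole, so \<open>T\<close> has a copy in the subdivision, and every
  chord has at most two pieces.\<close>

locale chord_subdivision = ribbon_graph G for G :: "('v, 'e) ribbon" +
  fixes d :: "'e \<Rightarrow> 'v" and n :: "'e \<Rightarrow> nat" and T :: "'e set"
  assumes d_end: "e \<in> edges G \<Longrightarrow> d e \<in> ends G e"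
    and n_le: "n e \<le> 1"
    and n_tree: "e \<in> T \<Longrightarrow> n e = 0"
    and T_tree: "spanning_tree G T"
begin

definition G' :: "('v + 'e \<times> nat, 'e \<times> nat) ribbon" where
  "G' = subdivide G d n"

text \<open>For an end \<open>v\<close> of \<open>e\<close>, the piece of \<open>e\<close> that
  touches the original vertex \<open>v\<close>.\<close>

definition piece :: "'v \<Rightarrow> 'e \<Rightarrow> 'e \<times> nat" where
  "piece v e = (e, if d e = v then 0 else n e)"

definition lift :: "'v \<times> 'e \<Rightarrow> ('v + 'e \<times> nat) \<times> 'e \<times> nat" where
  "lift h = (Inl (fst h), piece (fst h) (snd h))"

text \<open>The spanning trees of \<open>G'\<close> extending \<open>T\<close>: every chord \<open>e\<close> omits its piece \<open>k e\<close>.\<close>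

definition subtree :: "('e \<Rightarrow> nat) \<Rightarrow> ('e \<times> nat) set" where
  "subtree k = edges G' - (\<lambda>e. (e, k e)) ` (edges G - T)"

section \<open>Incidences, rotation and extended trees of the subdivision\<close>

lemma T_edges: "e \<in> T \<Longrightarrow> e \<in> edges G"
  using T_tree by (auto simp: spanning_tree_def)

lemma n_cases: obtains "n e = 0" | "n e = 1"
  using n_le[of e] by linarith

lemma edges_G': "(e, i) \<in> edges G' \<longleftrightarrow> e \<in> edges G \<and> i \<le> n e"
  by (simp add: G'_def subdivide_def)

lemma verts_G': "verts G' = Inl ` verts G \<union> {Inr (e, i) |e i. e \<in> edges G \<and> i < n e}"
  by (simp add: G'_def subdivide_def)

lemma ends_whole: "e \<in> edges G \<Longrightarrow> n e = 0 \<Longrightarrow> ends G' (e, 0) = Inl ` ends G e"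
  using edge_ends(1)[of e "d e"] d_end
  by (simp add: G'_def subdivide_def sub_point_def)

lemma ends_halves:
  assumes "n e = 1"
  shows "ends G' (e, 0) = {Inl (d e), Inr (e, 0)}"
    "ends G' (e, 1) = {Inr (e, 0), Inl (other_end G e (d e))}"
  using assms by (simp_all add: G'_def subdivide_def sub_point_def)

lemma Inr_in_ends:
  assumes "(e, i) \<in> edges G'"
  shows "Inr (f, j) \<in> ends G' (e, i) \<longleftrightarrow> f = e \<and> j = 0 \<and> n e = 1"
proof (cases e rule: n_cases)
  case 1
  then show ?thesis using assms ends_whole[of e] by (auto simp: edges_G')
next
  case 2
  then have "i = 0 \<or> i = 1" using assms by (auto simp: edges_G')
  then show ?thesis using ends_halves[OF 2] 2 by auto
qed

lemma multigraph_G': "multigraph G'"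
proof
  fix x assume x: "x \<in> edges G'"
  obtain e i where ei: "x = (e, i)" by (cases x)
  have e: "e \<in> edges G" "i \<le> n e" using x ei by (simp_all add: edges_G')
  have de: "ends G e = {d e, other_end G e (d e)}" "d e \<noteq> other_end G e (d e)"
    using edge_ends[of e "d e"] d_end e by auto
  have in_verts: "d e \<in> verts G" "other_end G e (d e) \<in> verts G"
    using ends_verts[OF e(1)] de by auto
  have "ends G' x \<subseteq> verts G' \<and> card (ends G' x) = 2"
  proof (cases e rule: n_cases)
    case 1
    then have "ends G' x = {Inl (d e), Inl (other_end G e (d e))}"
      using ends_whole e ei de by simp
    then show ?thesis using in_verts de(2) by (simp add: verts_G')
  next
    case 2
    then have "i = 0 \<or> i = 1" using e by auto
    then show ?thesis using ends_halves[OF 2] 2 in_verts e ei by (auto simp: verts_G')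
  qed
  then show "ends G' x \<subseteq> verts G'" "card (ends G' x) = 2" by auto
qed

lemma other_end_whole:
  assumes "(v, e) \<in> half_edges G" "n e = 0"
  shows "other_end G' (e, 0) (Inl v) = Inl (other_end G e v)"
proof (rule multigraph.other_end_eq[OF multigraph_G'])
  show "(e, 0) \<in> edges G'" using assms by (simp add: edges_G' half_edges_iff)
  show "ends G' (e, 0) = {Inl v, Inl (other_end G e v)}"
    using assms edge_ends(1)[of e v] ends_whole[of e] by (simp add: half_edges_iff)
qed

lemma ends_piece:
  assumes "(v, e) \<in> half_edges G" "n e = 1"
  shows "ends G' (piece v e) = {Inl v, Inr (e, 0)}" "piece v e \<in> edges G'"
proof -
  have "ends G e = {d e, other_end G e (d e)}"
    using assms edge_ends(1)[of e "d e"] d_end by (simp add: half_edges_iff)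
  then have "v = d e \<or> v = other_end G e (d e) \<and> v \<noteq> d e"
    using assms by (auto simp: half_edges_iff)
  then show "ends G' (piece v e) = {Inl v, Inr (e, 0)}"
    using ends_halves[OF assms(2)] assms by (auto simp: piece_def)
  show "piece v e \<in> edges G'" using assms by (simp add: piece_def edges_G' half_edges_iff)
qed

lemma other_end_piece:
  assumes "(v, e) \<in> half_edges G" "n e = 1"
  shows "other_end G' (piece v e) (Inl v) = Inr (e, 0)"
    "other_end G' (piece v e) (Inr (e, 0)) = Inl v"
  using multigraph.other_end_eq[OF multigraph_G' ends_piece(2)[OF assms]] ends_piece(1)[OF assms]
  by (auto simp: insert_commute)

lemma nxt_Inl: "nxt G' (Inl v) (e, i) = piece v (nxt G v e)"
  by (simp add: G'_def subdivide_def piece_def Let_def)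

lemma nxt_Inr: "nxt G' (Inr (e, 0)) (e, i) = (e, if i = 0 then 1 else 0)"
  by (simp add: G'_def subdivide_def)

lemma subtree_iff:
  "(e, i) \<in> subtree k \<longleftrightarrow> e \<in> edges G \<and> i \<le> n e \<and> (e \<in> T \<or> i \<noteq> k e)"
  by (auto simp: subtree_def edges_G')

lemma not_subtree_iff:
  "(\<And>e. k e \<le> n e) \<Longrightarrow> (e, i) \<in> edges G' - subtree k \<longleftrightarrow> e \<in> edges G - T \<and> i = k e"
  by (auto simp: subtree_def edges_G')

text \<open>The midpoint \<open>Inr (e, 0)\<close> has degree two, so a cycle entering it by one
  half leaves by the other.\<close>

lemma cycle_both_halves:
  assumes C: "is_cycle G' C" "(e, i) \<in> C" and n: "n e = 1"
  shows "(e, 0) \<in> C" "(e, 1) \<in> C"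
proof -
  have CE: "x \<in> edges G'" if "x \<in> C" for x
    using cycle_has_nonloop_edges(1)[OF C(1) that] .
  have "Inr (e, 0) \<in> ends G' (e, i)" using Inr_in_ends[OF CE[OF C(2)]] n by simp
  then obtain x where x: "x \<in> C" "x \<noteq> (e, i)" "Inr (e, 0) \<in> ends G' x"
    using cycle_not_leaf[OF C] by blast
  obtain j where j: "x = (e, j)" "j \<noteq> i"
    using x Inr_in_ends[of "fst x" "snd x" e 0] CE by (cases x) auto
  have "i \<le> 1" "j \<le> 1" using CE[OF C(2)] CE[OF x(1)] j n by (simp_all add: edges_G')
  then show "(e, 0) \<in> C" "(e, 1) \<in> C"
    using C(2) x(1) j by (auto simp: le_Suc_eq)
qed

text \<open>Unsubdivided edges have only original vertices as ends, so the cycle projects to a cycle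
  of \<open>G\<close> inside \<open>T\<close>.\<close>

lemma cycle_in_tree_copy:
  assumes C: "is_cycle G' C" "C \<subseteq> T \<times> {0}"
  shows False
proof -
  obtain vs es where l: "length vs = length es" "2 \<le> length es" "distinct vs" "distinct es"
    and en: "\<And>i. i < length es \<Longrightarrow> ends G' (es ! i) = {vs ! i, vs ! (Suc i mod length es)}"
    and C': "C = fst ` {(es ! i, vs ! (Suc i mod length es)) |i. i < length es}"
    using C unfolding is_cycle_def oriented_cycle_def by blast
  have C_eq: "C = set es" unfolding C' by (force simp: set_conv_nth)
  have es: "es ! i = (fst (es ! i), 0)" "fst (es ! i) \<in> T" if "i < length es" for i
    using subsetD[OF C(2), of "es ! i"] nth_mem[OF that] C_eq by (auto simp: mem_Times_iff prod_eq_iff)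
  have en': "Inl ` ends G (fst (es ! i)) = {vs ! i, vs ! (Suc i mod length es)}"
    if "i < length es" for i
    using en[OF that] es[OF that] ends_whole[of "fst (es ! i)"] T_edges n_tree by metis
  have vs: "vs ! i \<in> range Inl" if "i < length es" for i
    using en'[OF that] by auto
  have vs': "Inl (projl x) = x" if "x \<in> set vs" for x
    using that vs l(1) by (fastforce simp: in_set_conv_nth)
  let ?vs = "map projl vs" and ?es = "map fst es"
  have "oriented_cycle G {(?es ! i, ?vs ! (Suc i mod length ?es)) |i. i < length ?es}"
    unfolding oriented_cycle_def
  proof (intro exI[of _ ?vs] exI[of _ ?es] conjI allI impI)
    show "length ?vs = length ?es" "2 \<le> length ?es" using l by simp_all
    show "distinct ?vs"
      using l vs' by (auto simp: distinct_map intro!: inj_on_inverseI[of _ Inl])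
    show "distinct ?es"
      using l C(2) unfolding distinct_map C_eq by (auto simp: inj_on_def)
    show "set ?es \<subseteq> edges G" using C(2) T_edges unfolding C_eq by auto
    fix i assume "i < length ?es"
    then have i: "i < length es" by simp
    then have i': "Suc i mod length es < length es" by (intro mod_less_divisor) linarith
    note arg_cong[OF en'[OF i], of "image projl"]
    then show "ends G (?es ! i) = {?vs ! i, ?vs ! (Suc i mod length ?es)}"
      using i i' l(1) by (simp add: image_image)
  qed simp
  then have "is_cycle G (fst ` {(?es ! i, ?vs ! (Suc i mod length ?es)) |i. i < length ?es})"
    unfolding is_cycle_def by blast
  moreover have "fst ` {(?es ! i, ?vs ! (Suc i mod length ?es)) |i. i < length ?es} \<subseteq> T"
    using es by auto
  ultimately show False using T_tree by (auto simp: spanning_tree_def)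
qed

text \<open>The copy of \<open>T\<close> connects the original vertices, and each midpoint hangs on
  one of them by the half that is kept.\<close>

lemma subtree_connected:
  assumes k: "\<And>e. k e \<le> n e"
  shows "connected_by G' (subtree k)"
proof -
  let ?R = "(adj G' (subtree k))\<^sup>*"
  have T: "(Inl u, Inl v) \<in> ?R" if "(u, v) \<in> (adj G T)\<^sup>*" for u v
    using that
  proof (induction rule: rtrancl_induct)
    case (step y z)
    then obtain e where e: "e \<in> T" "ends G e = {y, z}" by (auto simp: adj_iff)
    then have "ends G' (e, 0) = {Inl y, Inl z}"
      using ends_whole[of e] T_edges n_tree by simp
    moreover have "(e, 0) \<in> subtree k" using e T_edges by (simp add: subtree_iff)
    ultimately have "(Inl y, Inl z) \<in> adj G' (subtree k)" by (auto simp: adj_iff)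
    with step.IH show ?case by (rule rtrancl.rtrancl_into_rtrancl)
  qed simp
  have V: "\<exists>v\<in>verts G. (x, Inl v) \<in> ?R" if x: "x \<in> verts G'" for x
  proof (cases "x \<in> Inl ` verts G")
    case True
    then show ?thesis by auto
  next
    case False
    then obtain e where e: "x = Inr (e, 0)" "e \<in> edges G" "n e = 1"
      using x n_le by (auto simp: verts_G') (metis One_nat_def less_Suc0 less_le_trans le_antisym Suc_leI)
    obtain v where v: "v \<in> ends G e" "piece v e \<noteq> (e, k e)"
    proof (cases "k e = 0")
      case True
      have "other_end G e (d e) \<in> ends G e" "d e \<noteq> other_end G e (d e)"
        using edge_ends[of e "d e"] d_end e by auto
      then show thesis using that[of "other_end G e (d e)"] True e by (simp add: piece_def)
    next
      case False
      then show thesis using that[of "d e"] d_end e by (simp add: piece_def)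
    qed
    have ve: "(v, e) \<in> half_edges G" using v e by (simp add: half_edges_iff)
    have "piece v e \<in> subtree k"
      using v ends_piece(2)[OF ve e(3)] by (auto simp: subtree_iff piece_def edges_G')
    then have "(x, Inl v) \<in> adj G' (subtree k)"
      using ends_piece(1)[OF ve e(3)] e by (auto simp: adj_iff insert_commute)
    then show ?thesis using half_edge_vert[OF ve] by auto
  qed
  show ?thesis
    unfolding connected_by_iff
  proof (intro ballI)
    fix x y assume "x \<in> verts G'" "y \<in> verts G'"
    then obtain u v where uv: "u \<in> verts G" "v \<in> verts G" "(x, Inl u) \<in> ?R" "(y, Inl v) \<in> ?R"
      using V by meson
    then have "(Inl u, Inl v) \<in> ?R"
      using T T_tree by (simp add: spanning_tree_def connected_by_iff)
    then show "(x, y) \<in> ?R"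
      using uv adj_rtrancl_swap[OF uv(4)] by (meson rtrancl_trans)
  qed
qed

text \<open>A cycle through one half of a chord contains the omitted half too, and whole chords are
  omitted altogether. A cycle could thus only lie in the copy of \<open>T\<close>.\<close>

lemma subtree_tree:
  assumes k: "\<And>e. k e \<le> n e"
  shows "spanning_tree G' (subtree k)"
  unfolding spanning_tree_def
proof (intro conjI allI impI notI)
  show "subtree k \<subseteq> edges G'" by (simp add: subtree_def)
  show "connected_by G' (subtree k)" by (rule subtree_connected[OF k])
  fix C assume C: "is_cycle G' C" "C \<subseteq> subtree k"
  have "C \<subseteq> T \<times> {0}"
  proof
    fix x assume x: "x \<in> C"
    obtain e i where ei: "x = (e, i)" by (cases x)
    have s: "(e, i) \<in> subtree k" using C x ei by auto
    have "e \<in> T"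
    proof (rule ccontr)
      assume "e \<notin> T"
      then have "i \<noteq> k e" "i \<le> n e" using s by (auto simp: subtree_iff)
      then have n: "n e = 1" and "k e = 0 \<or> k e = 1"
        using k[of e] n_le[of e] by auto
      then have "(e, k e) \<in> C" using cycle_both_halves[OF C(1), of e i] x ei by auto
      then show False using C(2) \<open>e \<notin> T\<close> by (auto simp: subtree_iff)
    qed
    then show "x \<in> T \<times> {0}" using s n_tree ei by (auto simp: subtree_iff)
  qed
  then show False using cycle_in_tree_copy[OF C(1)] by blast
qed

text \<open>One step of the tour of \<open>T\<close> lifts to one step, or to three if the kept half
  of a chord starts at \<open>h\<close>: out to the midpoint, past the missing half, and back. Only
  pieces of \<open>e\<close> are seen on the way, so the first visit to a piece of \<open>f\<close>
  is unaffected.\<close>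

lemma lift_pass:
  assumes k: "\<And>e. k e \<le> n e" and h: "h \<in> half_edges G" "snd h \<noteq> f"
    and v: "visits (tour_step G' (subtree k)) (f, i) (lift (tour_step G T h)) w"
  shows "visits (tour_step G' (subtree k)) (f, i) (lift h) w"
proof -
  obtain v e where ve: "h = (v, e)" by (cases h)
  have H: "(v, e) \<in> half_edges G" and E: "e \<in> edges G" "e \<noteq> f"
    using h ve by (auto simp: half_edges_iff)
  let ?s = "tour_step G' (subtree k)"
  show ?thesis
  proof (cases "e \<in> T")
    case True
    then have "n e = 0" by (rule n_tree)
    then have p: "piece u e = (e, 0)" for u by (simp add: piece_def)
    have "(e, 0) \<in> subtree k" using True E by (simp add: subtree_iff)
    then have "?s (lift h) = lift (tour_step G T h)"
      using True other_end_whole[OF H \<open>n e = 0\<close>]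
      by (simp add: tour_step_def lift_def ve p nxt_Inl Let_def)
    then show ?thesis using v E by (simp add: visits_later_iff lift_def ve p)
  next
    case False
    then have st: "lift (tour_step G T h) = (Inl v, piece v (nxt G v e))"
      by (simp add: lift_def tour_step_def ve)
    show ?thesis
    proof (cases "piece v e \<in> subtree k")
      case False
      then have "?s (lift h) = lift (tour_step G T h)"
        unfolding st by (simp add: tour_step_def lift_def ve nxt_Inl piece_def)
      then show ?thesis using v E by (simp add: visits_later_iff lift_def ve piece_def)
    next
      case True
      define i where "i = snd (piece v e)"
      have p: "piece v e = (e, i)" by (simp add: i_def piece_def)
      have i: "i \<noteq> k e" "i \<le> n e" using True False p by (auto simp: subtree_iff)
      then have n: "n e = 1" using k[of e] n_le[of e] by auto
      \<comment> \<open>The other half of \<open>e\<close>, which is the omitted one.\<close>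
      define j where "j = (if i = 0 then 1 else (0::nat))"
      have "i \<le> 1" "k e \<le> 1" using i n k[of e] by auto
      then have j: "j = k e" using i by (auto simp: j_def le_Suc_eq)
      have "?s (lift h) = (Inr (e, 0), e, j)"
        using True other_end_piece(1)[OF H n] p nxt_Inr[of e i]
        by (simp add: tour_step_def lift_def ve Let_def j_def)
      moreover have "(e, j) \<notin> subtree k" using j False by (simp add: subtree_iff)
      then have "?s (Inr (e, 0), e, j) = (Inr (e, 0), e, i)"
        using nxt_Inr[of e j] \<open>i \<le> 1\<close> by (auto simp: tour_step_def j_def le_Suc_eq)
      moreover have "?s (Inr (e, 0), e, i) = lift (tour_step G T h)"
        unfolding st using True other_end_piece(2)[OF H n] p nxt_Inl[of v e i]
        by (simp add: tour_step_def Let_def)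
      ultimately show ?thesis
        using v E by (simp add: visits_later_iff p lift_def ve)
    qed
  qed
qed

text \<open>If the omitted piece of \<open>f\<close> is the one at \<open>v\<close>, it is met
  there. Otherwise the tour first runs along the kept half and meets the omitted one at the
  midpoint.\<close>

lemma lift_visits:
  assumes k: "\<And>e. k e \<le> n e" and f: "f \<in> edges G - T"
    and "visits (tour_step G T) f h v" "h \<in> half_edges G"
  shows "visits (tour_step G' (subtree k)) (f, k f) (lift h)
    (if piece v f = (f, k f) then Inl v else Inr (f, 0))"
  using assms(3,4)
proof (induction rule: visits.induct)
  case (here h)
  obtain v where h: "h = (v, f)" using here by (cases h) simp
  let ?s = "tour_step G' (subtree k)"
  show ?case
  proof (cases "piece v f = (f, k f)")
    case True
    then show ?thesis using h by (simp add: visits_here_iff lift_def)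
  next
    case False
    define i where "i = snd (piece v f)"
    have p: "piece v f = (f, i)" by (simp add: i_def piece_def)
    have H: "(v, f) \<in> half_edges G" using here h by simp
    have i: "i \<noteq> k f" "i \<le> n f" using False p by (auto simp: piece_def split: if_splits)
    then have n: "n f = 1" using k[of f] n_le[of f] by auto
    then have "i \<le> 1" "k f \<le> 1" using i k[of f] by auto
    then have j: "k f = (if i = 0 then 1 else 0)" using i by (auto simp: le_Suc_eq)
    have "piece v f \<in> subtree k" using p i f by (simp add: subtree_iff)
    then have "?s (lift h) = (Inr (f, 0), f, k f)"
      using other_end_piece(1)[OF H n] p nxt_Inr[of f i] j
      by (simp add: tour_step_def lift_def h Let_def)
    then show ?thesis using False h p i by (simp add: visits_later_iff visits_here_iff lift_def)
  qed
next
  case (later h v)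
  then show ?case using lift_pass[OF k] tour_step_half_edge by blast
qed

end

subsection \<open>Subdividing a crossing pair\<close>

theorem theorem5p14:
  fixes G :: "('v, 'e) ribbon"
  assumes "ribbon_graph G"
    and "\<not> planar G"
  shows "\<exists>G'. subdivision G G' \<and> card (verts G') \<le> card (verts G) + 2 \<and>
    (\<exists>s. starting_pair G' s \<and>
      \<not> is_cycle_orientation_map G' (bernardi G' s) \<and>
      \<not> is_geometric_map G' (bernardi G' s))"
proof -
  interpret ribbon_graph G by fact
  obtain T where T: "spanning_tree G T"
    using spanning_tree_exists[OF finite_edges connected] by blast
  obtain f g where fg: "f \<in> edges G - T" "g \<in> edges G - T" "f \<noteq> g" "crossing T f g"
    using crossing_exists[OF assms(2) T] by blast
  then obtain c c' v w where c: "ends G g = {c, c'}" and vw: "v \<noteq> w"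
    and vis: "visits (tour_step G T) f (c, g) v" "visits (tour_step G T) f (c', g) w"
    unfolding crossing_def by blast
  have cc': "c \<noteq> c'" using ends_card[of g] fg c by auto
  have Hc: "(c, g) \<in> half_edges G" "(c', g) \<in> half_edges G"
    using fg c by (auto simp: half_edges_iff)
  have vf: "v \<in> ends G f" "w \<in> ends G f" using visits_end vis Hc by auto
  \<comment> \<open>Piece 0 of \<open>g\<close> lies at \<open>c\<close>, and piece 0 of
    \<open>f\<close> at \<open>v\<close>, the end met first from \<open>c\<close>.\<close>
  define d where "d = (\<lambda>e. if e = g then c else if e = f then v else SOME u. u \<in> ends G e)"
  define n :: "'e \<Rightarrow> nat" where "n e = of_bool (e = f \<or> e = g)" for e
  have d: "d e \<in> ends G e" if "e \<in> edges G" for e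
  proof -
    have "\<exists>u. u \<in> ends G e" using ends_card[OF that] by (auto simp: card_2_iff)
    then show ?thesis using c vf by (auto simp: d_def intro: someI_ex)
  qed
  interpret chord_subdivision G d n T
    using d T fg by unfold_locales (auto simp: n_def)
  interpret G': multigraph G' by (rule multigraph_G')
  let ?p = "Inr (g, 0)" and ?q = "Inr (f, 0)"
  define s where "s = (?p :: 'v + 'e \<times> nat, g, 0::nat)"
  \<comment> \<open>Both trees omit \<open>(f, 0)\<close>. With \<open>k1\<close> the half of
    \<open>g\<close> at \<open>c\<close> is kept, with \<open>k2\<close> the half at
    \<open>c'\<close>.\<close>
  define k1 k2 :: "'e \<Rightarrow> nat" where "k1 e = of_bool (e = g)" and "k2 e = 0" for e
  have k1: "k1 e \<le> n e" and k2: "k2 e \<le> n e" for e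
    by (simp_all add: k1_def k2_def n_def)
  have kf: "k1 f = 0" "k2 f = 0" "k1 g = 1" "k2 g = 0" using fg by (simp_all add: k1_def k2_def)
  have nfg: "n f = 1" "n g = 1" by (simp_all add: n_def)
  have pc: "piece c g = (g, 0)" "piece c' g = (g, 1)" "piece v f = (f, 0)" "piece w f = (f, 1)"
    unfolding piece_def using cc' vw fg(3) by (simp_all add: d_def n_def)
  let ?s = "\<lambda>k. tour_step G' (subtree k)"
  \<comment> \<open>From the midpoint of \<open>g\<close> the first tour runs to \<open>c\<close> at
    once. The second one, below, passes the missing half and then runs to \<open>c'\<close>. Both
    continue like the tour of \<open>T\<close> after \<open>g\<close>.\<close>
  have step1: "?s k1 s = lift (tour_step G T (c, g))"
    using other_end_piece(2)[OF Hc(1) nfg(2)] pc(1) fg kf nxt_Inl[of c g 0]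
    by (simp add: s_def tour_step_def subtree_iff lift_def Let_def)
  have step2: "?s k2 s = (?p, g, 1)" "?s k2 (?p, g, 1) = lift (tour_step G T (c', g))"
    using other_end_piece(2)[OF Hc(2) nfg(2)] pc(2) fg kf nxt_Inl[of c' g 1] nxt_Inr[of g 0] nfg
    by (simp_all add: s_def tour_step_def subtree_iff lift_def Let_def)
  have f1: "first_visit G' (subtree k1) s (f, 0) = Inl v"
  proof -
    have "visits (tour_step G T) f (tour_step G T (c, g)) v"
      using vis(1) fg(3) by (simp add: visits_later_iff)
    from lift_visits[OF k1 fg(1) this tour_step_half_edge[OF Hc(1)]]
    have "visits (?s k1) (f, 0) s (Inl v)"
      using pc kf fg(3) step1 by (subst visits_later_iff) (auto simp: s_def)
    then show ?thesis by (rule visits_first_visit)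
  qed
  \<comment> \<open>From \<open>c'\<close> the tour reaches \<open>f\<close> at \<open>w\<close>,
    whose half is kept, and so meets \<open>(f, 0)\<close> at the midpoint.\<close>
  have f2: "first_visit G' (subtree k2) s (f, 0) = ?q"
  proof -
    have "visits (tour_step G T) f (tour_step G T (c', g)) w"
      using vis(2) fg(3) by (simp add: visits_later_iff)
    from lift_visits[OF k2 fg(1) this tour_step_half_edge[OF Hc(2)]]
    have "visits (?s k2) (f, 0) (lift (tour_step G T (c', g))) ?q"
      using pc kf by simp
    then have "visits (?s k2) (f, 0) s ?q"
      using fg(3) step2 by (simp add: visits_later_iff s_def)
    then show ?thesis by (rule visits_first_visit)
  qed
  have other: "first_visit G' (subtree k) s (e, k e) \<noteq> ?q"
    if k: "k = k1 \<or> k = k2" and e: "e \<in> edges G - T" "e \<noteq> f" for k e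
  proof -
    have kn: "k e \<le> n e" for e using k k1 k2 by auto
    have lift: "\<exists>x. x \<noteq> ?q \<and> visits (?s k) (e, k e) (lift (tour_step G T (b, g))) x"
      if "b \<in> {c, c'}" for b
    proof -
      have b: "tour_step G T (b, g) \<in> half_edges G"
        using that Hc tour_step_half_edge by auto
      then obtain u where "visits (tour_step G T) e (tour_step G T (b, g)) u"
        using tree_visits[OF T b] e by blast
      from lift_visits[OF kn e(1) this b] show ?thesis
        using e(2) by (intro exI conjI) auto
    qed
    have "\<exists>x. x \<noteq> ?q \<and> visits (?s k) (e, k e) s x"
    proof (cases "k = k1")
      case True
      then have "(e, k e) \<noteq> (g, 0)" by (auto simp: k1_def)
      then have "snd s \<noteq> (e, k e)" by (auto simp: s_def)
      then show ?thesis using lift[of c] step1 True by (simp add: visits_later_iff)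
    next
      case False
      then have k: "k = k2" using k by simp
      show ?thesis
      proof (cases "e = g")
        case True
        \<comment> \<open>The missing half of \<open>g\<close> is the starting edge itself and is
          visited at \<open>?p\<close>.\<close>
        then show ?thesis using k kf fg by (auto simp: visits_here_iff s_def)
      next
        case False
        then have "snd s \<noteq> (e, k e)" "snd (?p :: 'v + 'e \<times> nat, g, 1) \<noteq> (e, k e)"
          by (auto simp: s_def)
        then show ?thesis using lift[of c'] step2 k by (simp add: visits_later_iff)
      qed
    qed
    then show ?thesis using visits_first_visit by metis
  qed
  have fin: "finite (edges G')"
  proof -
    have "edges G' \<subseteq> edges G \<times> {..1}" using n_le by (auto simp: edges_G' intro: le_trans)
    then show ?thesis using finite_edges finite_subset by blast
  qed
  have fT: "(f, 0) \<in> edges G' - subtree k" if "k = k1 \<or> k = k2" for k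
    using that fg kf by (auto simp: edges_G' subtree_iff)
  txt \<open>The only non-tree edge at \<open>?q\<close> is \<open>(f, 0)\<close>, so the number of chips there records its orientation.\<close>
  have single: "(\<Sum>x\<in>edges G' - subtree k. chip (\<phi> x) ?q) = of_bool (\<phi> (f, 0) = ?q)"
    if k: "k = k1 \<or> k = k2" and \<phi>: "\<And>e. e \<in> edges G - T \<Longrightarrow> e \<noteq> f \<Longrightarrow> \<phi> (e, k e) \<noteq> ?q"
    for k and \<phi> :: "'e \<times> nat \<Rightarrow> 'v + 'e \<times> nat"
  proof -
    have "chip (\<phi> x) ?q = 0" if "x \<in> edges G' - subtree k - {(f, 0)}" for x
    proof -
      obtain e i where x: "x = (e, i)" by (cases x)
      have "e \<in> edges G - T" "i = k e"
        using that x k not_subtree_iff[of k e i] k1 k2 by auto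
      then show ?thesis using \<phi>[of e] that x k kf by (auto simp: chip_def)
    qed
    then have "(\<Sum>x\<in>edges G' - subtree k. chip (\<phi> x) ?q) = chip (\<phi> (f, 0)) ?q"
      using fin fT[OF k] by (subst sum.remove[of _ "(f, 0)"]) auto
    then show ?thesis by (auto simp: chip_def)
  qed
  \<comment> \<open>Each tree together with \<open>(f, 0)\<close> contains only one half of
    \<open>g\<close>, so a cycle avoids \<open>g\<close>. Away from \<open>g\<close> the two trees
    agree.\<close>
  have sub: "C \<subseteq> insert (f, 0) (subtree k')"
    if C: "is_cycle G' C" "C \<subseteq> insert (f, 0) (subtree k)" and k: "{k, k'} = {k1, k2}" for C k k'
  proof
    fix x assume x: "x \<in> C"
    obtain e i where ei: "x = (e, i)" by (cases x)
    have "e \<noteq> g"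
    proof
      assume "e = g"
      then have "(g, k g) \<in> C"
        using cycle_both_halves[OF C(1), of g i] nfg x ei k kf by (auto simp: doubleton_eq_iff)
      then show False using C(2) fg by (auto simp: subtree_iff)
    qed
    then have "k e = k' e" using k by (auto simp: doubleton_eq_iff k1_def k2_def)
    then show "x \<in> insert (f, 0) (subtree k')" using C(2) x ei by (auto simp: subtree_iff)
  qed
  have fc: "fundamental_cycle G' (subtree k1) (f, 0) = fundamental_cycle G' (subtree k2) (f, 0)"
  proof -
    have "is_cycle G' C \<and> C \<subseteq> insert (f, 0) (subtree k1) \<longleftrightarrow>
        is_cycle G' C \<and> C \<subseteq> insert (f, 0) (subtree k2)" for C
      using sub[of C k1 k2] sub[of C k2 k1] insert_commute[of k1 k2 "{}"] by blast
    then show ?thesis by (simp add: fundamental_cycle_def)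
  qed
  have not_cycle_map: "\<not> is_cycle_orientation_map G' (bernardi G' s)"
  proof
    assume "is_cycle_orientation_map G' (bernardi G' s)"
    then obtain \<sigma> where \<sigma>: "cycle_orientation_config G' \<sigma>"
      and eq: "\<And>T. spanning_tree G' T \<Longrightarrow> bernardi G' s T = cycle_orientation_map G' \<sigma> T"
      by (auto simp: is_cycle_orientation_map_def)
    have "first_visit G' (subtree k) s (f, 0) = ?q \<longleftrightarrow>
        head_in (\<sigma> (fundamental_cycle G' (subtree k) (f, 0))) (f, 0) = ?q"
      if k: "k = k1 \<or> k = k2" for k
    proof -
      have kn: "k e \<le> n e" for e using k k1 k2 by auto
      have tree: "spanning_tree G' (subtree k)" by (rule subtree_tree[OF kn])
      have "head_in (\<sigma> (fundamental_cycle G' (subtree k) (e, k e))) (e, k e) \<noteq> ?q"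
        if e: "e \<in> edges G - T" "e \<noteq> f" for e
      proof -
        have x: "(e, k e) \<in> edges G' - subtree k" using e not_subtree_iff[OF kn] by blast
        let ?C = "fundamental_cycle G' (subtree k) (e, k e)"
        have "is_cycle G' ?C" "(e, k e) \<in> ?C"
          using G'.fundamental_cycle[OF tree x] by auto
        moreover from this have "oriented_cycle G' (\<sigma> ?C)" "fst ` \<sigma> ?C = ?C"
          using \<sigma> by (simp_all add: cycle_orientation_config_def)
        ultimately have "head_in (\<sigma> ?C) (e, k e) \<in> ends G' (e, k e)"
          by (intro G'.head_in_ends) simp_all
        \<comment> \<open>Only pieces of \<open>f\<close> end at \<open>?q\<close>, so no other
          chord can put a chip there.\<close>
        then show ?thesis using Inr_in_ends[of e "k e" f 0] x e(2) by auto
      qed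
      then show ?thesis
        using fun_cong[OF eq[OF tree], of ?q] single[OF k] other[OF k]
        by (simp add: bernardi_def cycle_orientation_map_def of_bool_eq_iff)
    qed
    \<comment> \<open>The common fundamental cycle forces the same head of \<open>(f, 0)\<close> for
      both trees, but the first visits are \<open>Inl v\<close> and \<open>?q\<close>.\<close>
    from this[of k1] this[of k2] show False using fc f1 f2 by simp
  qed
  moreover from not_cycle_map have "\<not> is_geometric_map G' (bernardi G' s)"
    by (auto simp: is_geometric_map_def is_cycle_orientation_map_def geometric_config_def)
  moreover have "starting_pair G' s"
    using ends_halves(1)[OF nfg(2)] fg by (simp add: starting_pair_def half_edges_iff s_def edges_G')
  moreover have "subdivision G G'"
    using d by (auto simp: subdivision_def G'_def)
  moreover have "card (verts G') \<le> card (verts G) + 2"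
  proof -
    have "verts G' \<subseteq> Inl ` verts G \<union> {?p, ?q}"
      by (auto simp: verts_G' n_def split: if_splits)
    then have "card (verts G') \<le> card (Inl ` verts G \<union> {?p, ?q} :: ('v + 'e \<times> nat) set)"
      using finite_verts by (intro card_mono) auto
    also have "\<dots> \<le> card (Inl ` verts G :: ('v + 'e \<times> nat) set) + card {?p, ?q :: 'v + 'e \<times> nat}"
      by (rule card_Un_le)
    also have "\<dots> \<le> card (verts G) + 2"
      by (intro add_mono card_image_le finite_verts) (simp add: card_insert_if)
    finally show ?thesis .
  qed
  ultimately show ?thesis by blast
qed

end
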